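(* Let $\underline{B}$ be a (full additive) negative subcategory of a triangulated category $\underline{C}'$ such that $\underline{C}'$ is densely generated by $\operatorname{Obj}\underline{B}$. Then the following statements are valid. 1. The envelopes $\underline{C}'_{w'\le 0}$ and $\underline{C}'_{w'\ge 0}$ of the classes $\bigcup_{i\le 0}\operatorname{Obj}\underline{B}[i]$ and $\bigcup_{i\ge 0}\operatorname{Obj}\underline{B}[i]$, respectively, give a weight structure $w'$ on $\underline{C}'$. 2. The heart of this weight structure $w'$ equals $\operatorname{Kar}_{\underline{C}'}(\underline{B})$. 3. $\operatorname{Obj}\operatorname{Kar}_{\underline{C}'}(\underline{B})$ strongly generates $\underline{C}'$. Moreover, $\underline{C}'_{w'\le 0}$ (resp. $\underline{C}'_{w'\ge 0}$) is the extension-closure of $\bigcup_{i\le 0}\operatorname{Obj}\operatorname{Kar}_{\underline{C}'}(\underline{B})[i]$ (resp. of $\bigcup_{i\ge 0}\operatorname{Obj}\operatorname{Kar}_{\underline{C}'}(\underline{B})[i]$). 4. $w'$ is the only weight structure on $\underline{C}'$ whose heart contains $\underline{B}$.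
   Context: $X$ is a retract of $Y$ if $\operatorname{id}_X$ factors through $Y$. A class of objects (or full subcategory) is retraction-closed if it contains all retracts of its elements. $D\perp E$ means that there are no non-zero morphisms from any $X\in D$ to any $Y\in E$. A full additive subcategory $\underline{B}$ of a triangulated category is negative if $\operatorname{Obj}\underline{B}\perp\bigcup_{i>0}\operatorname{Obj}(\underline{B}[i])$. $\operatorname{Kar}_{\underline{C}'}(\underline{B})$ is the retraction-closure of $\underline{B}$ in $\underline{C}'$, i.e. the smallest retraction-closed full subcategory of $\underline{C}'$ containing $\underline{B}$. A class $D$ of objects of a triangulated category is extension-closed if $0\in D$ and for any distinguished triangle $A\to E\to C$ with $A,C\in D$ we have $E\in D$. The extension-closure of a class is the smallest extension-closed class containing it; the envelope of a class is the smallest class containing it that is both extension-closed and retraction-closed. A class $D$ strongly generates $\underline{C}'$ if $\underline{C}'$ is the smallest full strict (isomorphism-closed) triangulated subcategory of $\underline{C}'$ containing $D$; $D$ densely generates $\underline{C}'$ if $\underline{C}'$ is the smallest retraction-closed full triangulated subcategory of $\underline{C}'$ containing $D$. A weight structure $w$ on a triangulated category $\underline{C}$ is a pair of classes $\underline{C}_{w\le 0},\underline{C}_{w\ge 0}\subset \operatorname{Obj}\underline{C}$ such that: (i) both are retraction-closed in $\underline{C}$; (ii) $\underline{C}_{w\le 0}\subset \underline{C}_{w\le 0}[1]$ and $\underline{C}_{w\ge 0}[1]\subset \underline{C}_{w\ge 0}$; (iii) $\underline{C}_{w\le 0}\perp \underline{C}_{w\ge 0}[1]$; (iv) for every $M\in\operatorname{Obj}\underline{C}$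 there is a distinguished triangle $X\to M\to Y\to X[1]$ with $X\in \underline{C}_{w\le 0}$ and $Y\in \underline{C}_{w\ge 0}[1]$. The heart of $w$ is the full subcategory with object class $\underline{C}_{w\ge 0}\cap\underline{C}_{w\le 0}$. *)

theory Defs
  imports "HOL-Algebra.Group"
begin

section \<open>Categories and additive categories\<close>

record ('o, 'm) category_data =
  Obj :: "'o set"
  Arr :: "'m set"
  Dom :: "'m \<Rightarrow> 'o"
  Cod :: "'m \<Rightarrow> 'o"
  ident :: "'o \<Rightarrow> 'm"
  comp_arr :: "'m \<Rightarrow> 'm \<Rightarrow> 'm"  (infixl \<open>\<bullet>\<index>\<close> 70)

definition Hom :: "('o, 'm, 'z) category_data_scheme \<Rightarrow> 'o \<Rightarrow> 'o \<Rightarrow> 'm set" where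
  "Hom C X Y = {f \<in> Arr C. Dom C f = X \<and> Cod C f = Y}"

locale category =
  fixes C :: "('o, 'm, 'z) category_data_scheme" (structure)
  assumes Dom_closed: "f \<in> Arr C \<Longrightarrow> Dom C f \<in> Obj C"
    and Cod_closed: "f \<in> Arr C \<Longrightarrow> Cod C f \<in> Obj C"
    and ident_closed: "X \<in> Obj C \<Longrightarrow> ident C X \<in> Hom C X X"
    and comp_closed: "\<lbrakk>f \<in> Hom C X Y; g \<in> Hom C Y Z\<rbrakk> \<Longrightarrow> g \<bullet> f \<in> Hom C X Z"
    and comp_ident: "f \<in> Hom C X Y \<Longrightarrow> f \<bullet> ident C X = f"
    and ident_comp: "f \<in> Hom C X Y \<Longrightarrow> ident C Y \<bullet> f = f"
    and comp_assoc: "\<lbrakk>f \<in> Hom C W X; g \<in> Hom C X Y; h \<in> Hom C Y Z\<rbrakk> \<Longrightarrow>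
      (h \<bullet> g) \<bullet> f = h \<bullet> (g \<bullet> f)"

definition iso_arrow :: "('o, 'm, 'z) category_data_scheme \<Rightarrow> 'm \<Rightarrow> 'o \<Rightarrow> 'o \<Rightarrow> bool" where
  "iso_arrow C f X Y \<longleftrightarrow> f \<in> Hom C X Y \<and>
    (\<exists>g \<in> Hom C Y X. g \<bullet>\<^bsub>C\<^esub> f = ident C X \<and> f \<bullet>\<^bsub>C\<^esub> g = ident C Y)"

definition isomorphic :: "('o, 'm, 'z) category_data_scheme \<Rightarrow> 'o \<Rightarrow> 'o \<Rightarrow> bool" where
  "isomorphic C X Y \<longleftrightarrow> (\<exists>f. iso_arrow C f X Y)"

definition retract_of :: "('o, 'm, 'z) category_data_scheme \<Rightarrow> 'o \<Rightarrow> 'o \<Rightarrow> bool" where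
  "retract_of C X Y \<longleftrightarrow> (\<exists>i \<in> Hom C X Y. \<exists>p \<in> Hom C Y X. p \<bullet>\<^bsub>C\<^esub> i = ident C X)"

definition zero_object :: "('o, 'm, 'z) category_data_scheme \<Rightarrow> 'o \<Rightarrow> bool" where
  "zero_object C Z \<longleftrightarrow> Z \<in> Obj C \<and>
    (\<forall>X \<in> Obj C. (\<exists>!f. f \<in> Hom C X Z) \<and> (\<exists>!f. f \<in> Hom C Z X))"

record ('o, 'm) additive_data = "('o, 'm) category_data" +
  plus_arr :: "'m \<Rightarrow> 'm \<Rightarrow> 'm"  (infixl \<open>\<oplus>\<index>\<close> 65)
  zero_arr :: "'o \<Rightarrow> 'o \<Rightarrow> 'm"

definition hom_group :: "('o, 'm, 'z) additive_data_scheme \<Rightarrow> 'o \<Rightarrow> 'o \<Rightarrow> 'm monoid" where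
  "hom_group C X Y = \<lparr>carrier = Hom C X Y, monoid.mult = plus_arr C, one = zero_arr C X Y\<rparr>"

definition neg_arr :: "('o, 'm, 'z) additive_data_scheme \<Rightarrow> 'm \<Rightarrow> 'm" where
  "neg_arr C f = inv\<^bsub>hom_group C (Dom C f) (Cod C f)\<^esub> f"

definition biproduct :: "('o, 'm, 'z) additive_data_scheme \<Rightarrow> 'o \<Rightarrow> 'o \<Rightarrow> 'o \<Rightarrow> bool" where
  "biproduct C X Y S \<longleftrightarrow> S \<in> Obj C \<and>
    (\<exists>i \<in> Hom C X S. \<exists>j \<in> Hom C Y S. \<exists>p \<in> Hom C S X. \<exists>q \<in> Hom C S Y.
      p \<bullet>\<^bsub>C\<^esub> i = ident C X \<and> q \<bullet>\<^bsub>C\<^esub> j = ident C Y \<and>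
      p \<bullet>\<^bsub>C\<^esub> j = zero_arr C Y X \<and> q \<bullet>\<^bsub>C\<^esub> i = zero_arr C X Y \<and>
      (i \<bullet>\<^bsub>C\<^esub> p) \<oplus>\<^bsub>C\<^esub> (j \<bullet>\<^bsub>C\<^esub> q) = ident C S)"

locale additive_category = category C
  for C :: "('o, 'm, 'z) additive_data_scheme" (structure) +
  assumes hom_comm_group: "\<lbrakk>X \<in> Obj C; Y \<in> Obj C\<rbrakk> \<Longrightarrow> comm_group (hom_group C X Y)"
    and comp_plus: "\<lbrakk>f \<in> Hom C X Y; f' \<in> Hom C X Y; g \<in> Hom C Y Z\<rbrakk> \<Longrightarrow>
      g \<bullet> (f \<oplus> f') = (g \<bullet> f) \<oplus> (g \<bullet> f')"
    and plus_comp: "\<lbrakk>f \<in> Hom C X Y; g \<in> Hom C Y Z; g' \<in> Hom C Y Z\<rbrakk> \<Longrightarrow>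
      (g \<oplus> g') \<bullet> f = (g \<bullet> f) \<oplus> (g' \<bullet> f)"
    and ex_zero_object: "\<exists>Z. zero_object C Z"
    and ex_biproduct: "\<lbrakk>X \<in> Obj C; Y \<in> Obj C\<rbrakk> \<Longrightarrow> \<exists>S. biproduct C X Y S"


section \<open>Triangulated categories\<close>

text \<open>
  A triangle \<open>X \<rightarrow> Y \<rightarrow> Z \<rightarrow> X[1]\<close> is represented by its three arrows, which determine the objects.
  The shift is an automorphism of the category (and not just a self-equivalence), so that
  \<open>[i]\<close> is defined on objects for every integer \<open>i\<close> and \<open>D[i]\<close> is the literal image of \<open>D\<close>.
\<close>

record ('o, 'm) triangulated_data = "('o, 'm) additive_data" +
  shift :: "'o \<Rightarrow> 'o"
  shift_arr :: "'m \<Rightarrow> 'm"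
  dist :: "('m \<times> 'm \<times> 'm) set"

definition triangle :: "('o, 'm, 'z) triangulated_data_scheme \<Rightarrow> 'm \<Rightarrow> 'm \<Rightarrow> 'm \<Rightarrow> bool" where
  "triangle C f g h \<longleftrightarrow> f \<in> Arr C \<and> g \<in> Arr C \<and> h \<in> Arr C \<and>
    Dom C g = Cod C f \<and> Dom C h = Cod C g \<and> Cod C h = shift C (Dom C f)"

locale triangulated_category = additive_category C
  for C :: "('o, 'm, 'z) triangulated_data_scheme" (structure) +
  assumes shift_bij: "bij_betw (shift C) (Obj C) (Obj C)"
    and shift_arr_bij: "bij_betw (shift_arr C) (Arr C) (Arr C)"
    and shift_arr_hom: "f \<in> Hom C X Y \<Longrightarrow> shift_arr C f \<in> Hom C (shift C X) (shift C Y)"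
    and shift_ident: "X \<in> Obj C \<Longrightarrow> shift_arr C (ident C X) = ident C (shift C X)"
    and shift_comp: "\<lbrakk>f \<in> Hom C X Y; g \<in> Hom C Y Z\<rbrakk> \<Longrightarrow>
      shift_arr C (g \<bullet> f) = shift_arr C g \<bullet> shift_arr C f"
    and shift_plus: "\<lbrakk>f \<in> Hom C X Y; g \<in> Hom C X Y\<rbrakk> \<Longrightarrow>
      shift_arr C (f \<oplus> g) = shift_arr C f \<oplus> shift_arr C g"
    and dist_triangle: "(f, g, h) \<in> dist C \<Longrightarrow> triangle C f g h"
    and TR1_ident: "\<lbrakk>X \<in> Obj C; zero_object C Z\<rbrakk> \<Longrightarrow>
      (ident C X, zero_arr C X Z, zero_arr C Z (shift C X)) \<in> dist C"
    and TR1_cone: "f \<in> Arr C \<Longrightarrow> \<exists>g h. (f, g, h) \<in> dist C"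
    and TR1_iso: "\<lbrakk>(f, g, h) \<in> dist C; triangle C f' g' h';
      iso_arrow C a (Dom C f) (Dom C f'); iso_arrow C b (Dom C g) (Dom C g');
      iso_arrow C c (Dom C h) (Dom C h');
      b \<bullet> f = f' \<bullet> a; c \<bullet> g = g' \<bullet> b; shift_arr C a \<bullet> h = h' \<bullet> c\<rbrakk> \<Longrightarrow> (f', g', h') \<in> dist C"
    and TR2: "triangle C f g h \<Longrightarrow>
      (f, g, h) \<in> dist C \<longleftrightarrow> (g, h, neg_arr C (shift_arr C f)) \<in> dist C"
    and TR3: "\<lbrakk>(f, g, h) \<in> dist C; (f', g', h') \<in> dist C;
      a \<in> Hom C (Dom C f) (Dom C f'); b \<in> Hom C (Dom C g) (Dom C g'); b \<bullet> f = f' \<bullet> a\<rbrakk> \<Longrightarrow>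
      \<exists>c \<in> Hom C (Dom C h) (Dom C h'). c \<bullet> g = g' \<bullet> b \<and> shift_arr C a \<bullet> h = h' \<bullet> c"
    and TR4: "\<lbrakk>f \<in> Hom C X Y; g \<in> Hom C Y Z;
      (f, f1, f2) \<in> dist C; (g, g1, g2) \<in> dist C; (g \<bullet> f, k1, k2) \<in> dist C\<rbrakk> \<Longrightarrow>
      \<exists>a \<in> Hom C (Cod C f1) (Cod C k1). \<exists>b \<in> Hom C (Cod C k1) (Cod C g1).
        (a, b, shift_arr C f1 \<bullet> g2) \<in> dist C \<and>
        a \<bullet> f1 = k1 \<bullet> g \<and> k2 \<bullet> a = f2 \<and> b \<bullet> k1 = g1 \<and> g2 \<bullet> b = shift_arr C f \<bullet> k2"

definition shift_int :: "('o, 'm, 'z) triangulated_data_scheme \<Rightarrow> int \<Rightarrow> 'o \<Rightarrow> 'o" where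
  "shift_int C i X =
    (if 0 \<le> i then (shift C ^^ nat i) X else (inv_into (Obj C) (shift C) ^^ nat (- i)) X)"

definition shifts :: "('o, 'm, 'z) triangulated_data_scheme \<Rightarrow> int set \<Rightarrow> 'o set \<Rightarrow> 'o set" where
  "shifts C I D = (\<Union>i \<in> I. shift_int C i ` D)"


section \<open>Classes of objects\<close>

text \<open>Full subcategories are identified with their classes of objects.\<close>

definition perp :: "('o, 'm, 'z) additive_data_scheme \<Rightarrow> 'o set \<Rightarrow> 'o set \<Rightarrow> bool" where
  "perp C D E \<longleftrightarrow> (\<forall>X \<in> D. \<forall>Y \<in> E. \<forall>f \<in> Hom C X Y. f = zero_arr C X Y)"

definition iso_closed :: "('o, 'm, 'z) category_data_scheme \<Rightarrow> 'o set \<Rightarrow> bool" where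
  "iso_closed C D \<longleftrightarrow> D \<subseteq> Obj C \<and> (\<forall>Y \<in> D. \<forall>X \<in> Obj C. isomorphic C X Y \<longrightarrow> X \<in> D)"

definition retraction_closed :: "('o, 'm, 'z) category_data_scheme \<Rightarrow> 'o set \<Rightarrow> bool" where
  "retraction_closed C D \<longleftrightarrow> D \<subseteq> Obj C \<and> (\<forall>Y \<in> D. \<forall>X \<in> Obj C. retract_of C X Y \<longrightarrow> X \<in> D)"

definition Kar :: "('o, 'm, 'z) category_data_scheme \<Rightarrow> 'o set \<Rightarrow> 'o set" where
  "Kar C B = \<Inter>{E. retraction_closed C E \<and> B \<subseteq> E}"

text \<open>
  A class containing one zero object and closed under extensions contains all zero objects,
  so it does not matter which of them is meant by \<open>0 \<in> D\<close>.
\<close>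

definition extension_closed :: "('o, 'm, 'z) triangulated_data_scheme \<Rightarrow> 'o set \<Rightarrow> bool" where
  "extension_closed C D \<longleftrightarrow> D \<subseteq> Obj C \<and> (\<forall>Z. zero_object C Z \<longrightarrow> Z \<in> D) \<and>
    (\<forall>f g h. (f, g, h) \<in> dist C \<and> Dom C f \<in> D \<and> Cod C g \<in> D \<longrightarrow> Cod C f \<in> D)"

definition extension_closure :: "('o, 'm, 'z) triangulated_data_scheme \<Rightarrow> 'o set \<Rightarrow> 'o set" where
  "extension_closure C D = \<Inter>{E. extension_closed C E \<and> D \<subseteq> E}"

definition envelope :: "('o, 'm, 'z) triangulated_data_scheme \<Rightarrow> 'o set \<Rightarrow> 'o set" where
  "envelope C D = \<Inter>{E. extension_closed C E \<and> retraction_closed C E \<and> D \<subseteq> E}"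

definition full_additive_subcategory ::
    "('o, 'm, 'z) additive_data_scheme \<Rightarrow> 'o set \<Rightarrow> bool" where
  "full_additive_subcategory C B \<longleftrightarrow> B \<subseteq> Obj C \<and> (\<exists>Z \<in> B. zero_object C Z) \<and>
    (\<forall>X \<in> B. \<forall>Y \<in> B. \<exists>S \<in> B. biproduct C X Y S)"

definition negative :: "('o, 'm, 'z) triangulated_data_scheme \<Rightarrow> 'o set \<Rightarrow> bool" where
  "negative C B \<longleftrightarrow> perp C B (shifts C {0<..} B)"

definition full_triangulated_subcategory ::
    "('o, 'm, 'z) triangulated_data_scheme \<Rightarrow> 'o set \<Rightarrow> bool" where
  "full_triangulated_subcategory C D \<longleftrightarrow> full_additive_subcategory C D \<and> shift C ` D = D \<and>
    (\<forall>f \<in> Arr C. Dom C f \<in> D \<and> Cod C f \<in> D \<longrightarrow> (\<exists>g h. (f, g, h) \<in> dist C \<and> Cod C g \<in> D))"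

definition strongly_generates ::
    "('o, 'm, 'z) triangulated_data_scheme \<Rightarrow> 'o set \<Rightarrow> bool" where
  "strongly_generates C D \<longleftrightarrow>
    Obj C = \<Inter>{T. full_triangulated_subcategory C T \<and> iso_closed C T \<and> D \<subseteq> T}"

definition densely_generates ::
    "('o, 'm, 'z) triangulated_data_scheme \<Rightarrow> 'o set \<Rightarrow> bool" where
  "densely_generates C D \<longleftrightarrow>
    Obj C = \<Inter>{T. full_triangulated_subcategory C T \<and> retraction_closed C T \<and> D \<subseteq> T}"


section \<open>Weight structures\<close>

definition weight_structure ::
    "('o, 'm, 'z) triangulated_data_scheme \<Rightarrow> 'o set \<Rightarrow> 'o set \<Rightarrow> bool" where
  "weight_structure C wle wge \<longleftrightarrow>
    retraction_closed C wle \<and> retraction_closed C wge \<and>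
    wle \<subseteq> shift C ` wle \<and> shift C ` wge \<subseteq> wge \<and>
    perp C wle (shift C ` wge) \<and>
    (\<forall>M \<in> Obj C. \<exists>f g h. (f, g, h) \<in> dist C \<and>
      Dom C f \<in> wle \<and> Cod C f = M \<and> Cod C g \<in> shift C ` wge)"

definition heart :: "'o set \<Rightarrow> 'o set \<Rightarrow> 'o set" where
  "heart wle wge = wge \<inter> wle"

end

theory Submission
  imports Defs
begin

text \<open>
  Write \<open>K\<close> for the retraction-closure of \<open>B\<close> and \<open>E(I)\<close> for the extension-closure of the \<open>K[i]\<close>,
  \<open>i \<in> I\<close>. Negativity gives \<open>E(I) \<perp> E(J)\<close> whenever \<open>I < J\<close>, and together with the octahedral axiom
  that every object of \<open>E(I \<union> J)\<close> is an extension of an object of \<open>E(J)\<close> by an object of \<open>E(I)\<close>.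
  The point is that \<open>E({a..b})\<close> is closed under retracts, by induction on \<open>b - a\<close>: if \<open>M\<close> is a
  retract of \<open>N\<close>, then \<open>M \<oplus> M[1]\<close> is the cone of an endomorphism of \<open>N\<close> and so lies in
  \<open>E({a..b+1})\<close>; its component \<open>X \<in> K[a]\<close> maps trivially to \<open>M[1]\<close>, and the cone of \<open>X \<rightarrow> M\<close> turns out to be
  a retract of an object of \<open>E({a+1..b})\<close>. Hence \<open>E(\<int>)\<close> is a retraction-closed triangulated
  subcategory, i.e. everything, and \<open>E({..0})\<close>, \<open>E({0..})\<close> are the envelopes in question.
\<close>

section \<open>Additive categories\<close>

text \<open>Idempotents are not assumed to split, so a retract \<open>M\<close> of \<open>N\<close>,
  with \<open>p i = 1\<close>, need not have a complementary summand that could be used to cut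
  \<open>M\<close> out of \<open>N\<close>. If it had one, \<open>1 - i p\<close> would vanish on
  \<open>M\<close> and be invertible on the complement, so its cone would be
  \<open>M + M[1]\<close>. The cone exists in any case, and only two facts about it are used:
  \<open>M\<close> is a retract of it, and the complementary projector factors through
  \<open>N[1]\<close>. The price is one surplus weight \<open>b + 1\<close>. A second truncation
  removes it: neither \<open>M\<close> nor \<open>X[1]\<close> has arrows to weight
  \<open>b + 1\<close>, hence neither has the cone of \<open>X -> M\<close>, so the inclusion of
  that cone lifts to the part of weights at most \<open>b\<close>. The induction starts from
  \<open>K[a]\<close> being extension-closed: by negativity an extension of objects of
  \<open>K\<close> splits, and \<open>B\<close> has biproducts. Infinite ranges of weights reduce to
  intervals, because every object is built from finitely many shifts. Uniqueness rests on each half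
  of a weight structure being the orthogonal of the other, so that nested weight structures
  coincide.\<close>

context category
begin

lemma Hom_Obj:
  assumes "f \<in> Hom C X Y"
  shows "X \<in> Obj C" "Y \<in> Obj C"
  using assms Dom_closed Cod_closed unfolding Hom_def by auto

lemma retract_of_trans:
  assumes "retract_of C X Y" "retract_of C Y Z"
  shows "retract_of C X Z"
proof -
  obtain i p where ip: "i \<in> Hom C X Y" "p \<in> Hom C Y X" "p \<bullet> i = ident C X"
    using assms(1) unfolding retract_of_def by blast
  obtain j q where jq: "j \<in> Hom C Y Z" "q \<in> Hom C Z Y" "q \<bullet> j = ident C Y"
    using assms(2) unfolding retract_of_def by blast
  have "(p \<bullet> q) \<bullet> (j \<bullet> i) = p \<bullet> (q \<bullet> (j \<bullet> i))"
    using comp_assoc ip jq comp_closed by blast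
  also have "q \<bullet> (j \<bullet> i) = (q \<bullet> j) \<bullet> i"
    using comp_assoc ip jq by metis
  also have "\<dots> = i" using ident_comp ip jq by metis
  finally have "(p \<bullet> q) \<bullet> (j \<bullet> i) = ident C X" using ip by simp
  then show ?thesis
    unfolding retract_of_def using ip jq comp_closed by blast
qed

lemma retract_of_refl: "X \<in> Obj C \<Longrightarrow> retract_of C X X"
  unfolding retract_of_def using ident_closed ident_comp by blast

lemma isomorphic_retract_of: "isomorphic C X Y \<Longrightarrow> retract_of C X Y"
  unfolding isomorphic_def iso_arrow_def retract_of_def by blast

text \<open>Retracts of retracts are retracts, so a single step already gives a closed class.
  Membership then comes with an explicit object of \<open>B\<close>.\<close>

lemma Kar_eq:
  assumes "B \<subseteq> Obj C"
  shows "Kar C B = {X \<in> Obj C. \<exists>Y \<in> B. retract_of C X Y}"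
proof
  have "retraction_closed C {X \<in> Obj C. \<exists>Y \<in> B. retract_of C X Y}"
    unfolding retraction_closed_def using retract_of_trans by blast
  moreover have "B \<subseteq> {X \<in> Obj C. \<exists>Y \<in> B. retract_of C X Y}"
    using assms retract_of_refl by blast
  ultimately show "Kar C B \<subseteq> {X \<in> Obj C. \<exists>Y \<in> B. retract_of C X Y}"
    unfolding Kar_def by blast
  show "{X \<in> Obj C. \<exists>Y \<in> B. retract_of C X Y} \<subseteq> Kar C B"
    unfolding Kar_def retraction_closed_def by blast
qed

lemma retraction_closed_Kar: "B \<subseteq> Obj C \<Longrightarrow> retraction_closed C (Kar C B)"
  unfolding Kar_eq retraction_closed_def using retract_of_trans by blast

lemma subset_Kar: "B \<subseteq> Kar C B"
  unfolding Kar_def by blast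

end

context additive_category
begin

lemma zero_closed: "\<lbrakk>X \<in> Obj C; Y \<in> Obj C\<rbrakk> \<Longrightarrow> zero_arr C X Y \<in> Hom C X Y"
proof -
  assume "X \<in> Obj C" "Y \<in> Obj C"
  then interpret G: comm_group "hom_group C X Y" by (rule hom_comm_group)
  show ?thesis using G.one_closed by (simp add: hom_group_def)
qed

lemma plus_closed:
  assumes "f \<in> Hom C X Y" "g \<in> Hom C X Y"
  shows "f \<oplus> g \<in> Hom C X Y"
proof -
  interpret G: comm_group "hom_group C X Y" by (rule hom_comm_group) (use assms Hom_Obj in auto)
  show ?thesis using G.m_closed[of f g] assms by (simp add: hom_group_def)
qed

lemma plus_commute:
  assumes "f \<in> Hom C X Y" "g \<in> Hom C X Y"
  shows "f \<oplus> g = g \<oplus> f"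
proof -
  interpret G: comm_group "hom_group C X Y" by (rule hom_comm_group) (use assms Hom_Obj in auto)
  show ?thesis using G.m_comm[of f g] assms by (simp add: hom_group_def)
qed

lemma plus_zero:
  assumes "f \<in> Hom C X Y"
  shows "f \<oplus> zero_arr C X Y = f"
proof -
  interpret G: comm_group "hom_group C X Y" by (rule hom_comm_group) (use assms Hom_Obj in auto)
  show ?thesis using G.r_one[of f] assms by (simp add: hom_group_def)
qed

lemma plus_left_cancel:
  assumes "f \<in> Hom C X Y" "g \<in> Hom C X Y" "h \<in> Hom C X Y" "f \<oplus> g = f \<oplus> h"
  shows "g = h"
proof -
  interpret G: comm_group "hom_group C X Y" by (rule hom_comm_group) (use assms Hom_Obj in auto)
  show ?thesis using G.Units_l_cancel[of f g h] G.Units_eq assms by (simp add: hom_group_def)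
qed

text \<open>The usual way of showing that a complement \<open>d = 1 - e\<close> kills something: if
  \<open>e\<close> fixes an arrow, distributing \<open>1 = e + d\<close> over it leaves an equation
  of this shape.\<close>

lemma plus_eq_self:
  assumes "f \<in> Hom C X Y" "g \<in> Hom C X Y" "f \<oplus> g = f"
  shows "g = zero_arr C X Y"
  using assms plus_left_cancel plus_zero zero_closed Hom_Obj by metis

text \<open>Subtraction in the form used below: a complement of an idempotent or an error term
  \<open>1 - c\<close> enters as some \<open>d\<close> with \<open>c + d = 1\<close>, which avoids
  computing with signs.\<close>

lemma ex_diff:
  assumes "f \<in> Hom C X Y" "g \<in> Hom C X Y"
  obtains d where "d \<in> Hom C X Y" "f \<oplus> d = g"
proof -
  interpret G: comm_group "hom_group C X Y" by (rule hom_comm_group) (use assms Hom_Obj in auto)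
  let ?i = "inv\<^bsub>hom_group C X Y\<^esub> f"
  have c: "carrier (hom_group C X Y) = Hom C X Y" by (simp add: hom_group_def)
  have "f \<otimes>\<^bsub>hom_group C X Y\<^esub> (?i \<otimes>\<^bsub>hom_group C X Y\<^esub> g) = g"
    using assms c G.inv_solve_left by (metis G.inv_closed G.m_closed)
  moreover have "?i \<otimes>\<^bsub>hom_group C X Y\<^esub> g \<in> Hom C X Y"
    using assms c by (metis G.inv_closed G.m_closed)
  ultimately show thesis using that by (simp add: hom_group_def)
qed

lemma neg_closed:
  assumes "f \<in> Hom C X Y"
  shows "neg_arr C f \<in> Hom C X Y"
proof -
  interpret G: comm_group "hom_group C X Y" by (rule hom_comm_group) (use assms Hom_Obj in auto)
  show ?thesis using G.inv_closed[of f] assms by (simp add: hom_group_def neg_arr_def Hom_def)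
qed

lemma plus_neg:
  assumes "f \<in> Hom C X Y"
  shows "f \<oplus> neg_arr C f = zero_arr C X Y"
proof -
  interpret G: comm_group "hom_group C X Y" by (rule hom_comm_group) (use assms Hom_Obj in auto)
  show ?thesis using G.r_inv[of f] assms by (simp add: hom_group_def neg_arr_def Hom_def)
qed

lemma neg_unique:
  assumes "f \<in> Hom C X Y" "g \<in> Hom C X Y" "f \<oplus> g = zero_arr C X Y"
  shows "g = neg_arr C f"
  using assms plus_left_cancel plus_neg neg_closed by metis

lemma neg_neg:
  assumes "f \<in> Hom C X Y"
  shows "neg_arr C (neg_arr C f) = f"
  using assms neg_unique[of "neg_arr C f" X Y f] plus_neg neg_closed plus_commute by metis

lemma comp_zero:
  assumes "X \<in> Obj C" "g \<in> Hom C Y Z"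
  shows "g \<bullet> zero_arr C X Y = zero_arr C X Z"
proof -
  have z: "zero_arr C X Y \<in> Hom C X Y" using assms zero_closed Hom_Obj by blast
  have "(g \<bullet> zero_arr C X Y) \<oplus> (g \<bullet> zero_arr C X Y) = g \<bullet> zero_arr C X Y"
    using comp_plus[OF z z assms(2)] plus_zero[OF z] by simp
  then show ?thesis using plus_eq_self comp_closed[OF z assms(2)] by blast
qed

lemma zero_comp:
  assumes "Z \<in> Obj C" "f \<in> Hom C X Y"
  shows "zero_arr C Y Z \<bullet> f = zero_arr C X Z"
proof -
  have z: "zero_arr C Y Z \<in> Hom C Y Z" using assms zero_closed Hom_Obj by blast
  have "(zero_arr C Y Z \<bullet> f) \<oplus> (zero_arr C Y Z \<bullet> f) = zero_arr C Y Z \<bullet> f"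
    using plus_comp[OF assms(2) z z] plus_zero[OF z] by simp
  then show ?thesis using plus_eq_self comp_closed[OF assms(2) z] by blast
qed

lemma comp_neg:
  assumes "f \<in> Hom C X Y" "g \<in> Hom C Y Z"
  shows "g \<bullet> neg_arr C f = neg_arr C (g \<bullet> f)"
proof (rule neg_unique)
  show "g \<bullet> f \<in> Hom C X Z" "g \<bullet> neg_arr C f \<in> Hom C X Z"
    using assms comp_closed neg_closed by blast+
  show "(g \<bullet> f) \<oplus> (g \<bullet> neg_arr C f) = zero_arr C X Z"
    using comp_plus[OF assms(1) neg_closed[OF assms(1)] assms(2)] plus_neg[OF assms(1)]
      comp_zero[of X g] assms Hom_Obj by metis
qed

lemma neg_comp:
  assumes "f \<in> Hom C X Y" "g \<in> Hom C Y Z"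
  shows "neg_arr C g \<bullet> f = neg_arr C (g \<bullet> f)"
proof (rule neg_unique)
  show "g \<bullet> f \<in> Hom C X Z" "neg_arr C g \<bullet> f \<in> Hom C X Z"
    using assms comp_closed neg_closed by blast+
  show "(g \<bullet> f) \<oplus> (neg_arr C g \<bullet> f) = zero_arr C X Z"
    using plus_comp[OF assms(1) assms(2) neg_closed[OF assms(2)]] plus_neg[OF assms(2)]
      zero_comp[of Z f] assms Hom_Obj by metis
qed

lemma zero_object_Obj: "zero_object C Z \<Longrightarrow> Z \<in> Obj C"
  unfolding zero_object_def by blast

lemma zero_object_Hom_to:
  assumes "zero_object C Z" "f \<in> Hom C X Z"
  shows "f = zero_arr C X Z"
  using assms zero_closed Hom_Obj unfolding zero_object_def by metis

lemma zero_object_Hom_from: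
  assumes "zero_object C Z" "f \<in> Hom C Z X"
  shows "f = zero_arr C Z X"
  using assms zero_closed Hom_Obj unfolding zero_object_def by metis

text \<open>If the identity of \<open>Z\<close> vanishes, then so does every arrow into or out of
  \<open>Z\<close>, by composing with it. This equational criterion is easy to transport along the
  shift.\<close>

lemma zero_object_iff:
  "zero_object C Z \<longleftrightarrow> Z \<in> Obj C \<and> ident C Z = zero_arr C Z Z"
proof
  assume "zero_object C Z"
  then show "Z \<in> Obj C \<and> ident C Z = zero_arr C Z Z"
    using zero_object_Obj zero_object_Hom_to ident_closed by blast
next
  assume Z: "Z \<in> Obj C \<and> ident C Z = zero_arr C Z Z"
  have "f = zero_arr C X Z" if "X \<in> Obj C" "f \<in> Hom C X Z" for X f
    using ident_comp[OF that(2)] zero_comp[OF _ that(2), of Z] Z by simp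
  moreover have "f = zero_arr C Z X" if "X \<in> Obj C" "f \<in> Hom C Z X" for X f
    using comp_ident[OF that(2)] comp_zero[OF _ that(2), of Z] Z by simp
  ultimately show "zero_object C Z"
    unfolding zero_object_def using Z zero_closed by metis
qed

lemma zero_objects_isomorphic:
  assumes "zero_object C Z" "zero_object C Z'"
  shows "isomorphic C Z Z'"
proof -
  have O: "Z \<in> Obj C" "Z' \<in> Obj C" using assms zero_object_Obj by auto
  have "zero_arr C Z' Z \<bullet> zero_arr C Z Z' = ident C Z"
    "zero_arr C Z Z' \<bullet> zero_arr C Z' Z = ident C Z'"
    using O zero_closed comp_zero assms zero_object_iff by metis+
  then show ?thesis unfolding isomorphic_def iso_arrow_def using O zero_closed by blast
qed

lemma perp_retract_left:
  assumes "perp C {Y} E" "retract_of C X Y" "X \<in> Obj C" "E \<subseteq> Obj C"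
  shows "perp C {X} E"
proof -
  obtain i p where ip: "i \<in> Hom C X Y" "p \<in> Hom C Y X" "p \<bullet> i = ident C X"
    using assms(2) unfolding retract_of_def by blast
  have "f = zero_arr C X W" if "W \<in> E" "f \<in> Hom C X W" for W f
  proof -
    have "f \<bullet> p = zero_arr C Y W"
      using assms(1) that ip comp_closed unfolding perp_def by blast
    moreover have "(f \<bullet> p) \<bullet> i = f"
      using comp_assoc[OF ip(1) ip(2) that(2)] comp_ident[OF that(2)] ip(3) by simp
    ultimately show ?thesis using zero_comp[OF _ ip(1)] that assms(4) by auto
  qed
  then show ?thesis unfolding perp_def by blast
qed

lemma perp_retract_right:
  assumes "perp C E {Y}" "retract_of C X Y" "X \<in> Obj C" "E \<subseteq> Obj C"
  shows "perp C E {X}"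
proof -
  obtain i p where ip: "i \<in> Hom C X Y" "p \<in> Hom C Y X" "p \<bullet> i = ident C X"
    using assms(2) unfolding retract_of_def by blast
  have "f = zero_arr C W X" if "W \<in> E" "f \<in> Hom C W X" for W f
  proof -
    have "i \<bullet> f = zero_arr C W Y"
      using assms(1) that ip comp_closed unfolding perp_def by blast
    moreover have "p \<bullet> (i \<bullet> f) = f"
      using comp_assoc[OF that(2) ip(1) ip(2)] ident_comp[OF that(2)] ip(3) by simp
    ultimately show ?thesis using comp_zero[OF _ ip(2)] that assms(4) by auto
  qed
  then show ?thesis unfolding perp_def by blast
qed

end

section \<open>Distinguished triangles\<close>

context triangulated_category
begin

text \<open>Names the objects of a distinguished triangle: \<open>dist\<close> holds bare arrows,
  whereas the laws of composition ask for \<open>Hom\<close> memberships with explicit end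
  points.\<close>

definition dtri :: "'o \<Rightarrow> 'o \<Rightarrow> 'o \<Rightarrow> 'm \<Rightarrow> 'm \<Rightarrow> 'm \<Rightarrow> bool" where
  "dtri X Y Z f g h \<longleftrightarrow> f \<in> Hom C X Y \<and> g \<in> Hom C Y Z \<and> h \<in> Hom C Z (shift C X) \<and>
    (f, g, h) \<in> dist C"

lemma dtri_Hom:
  assumes "dtri X Y Z f g h"
  shows "f \<in> Hom C X Y" "g \<in> Hom C Y Z" "h \<in> Hom C Z (shift C X)"
  using assms unfolding dtri_def by auto

lemma dtri_Obj:
  assumes "dtri X Y Z f g h"
  shows "X \<in> Obj C" "Y \<in> Obj C" "Z \<in> Obj C"
  using dtri_Hom[OF assms] Hom_Obj by auto

lemma dist_imp_dtri: "(f, g, h) \<in> dist C \<Longrightarrow> dtri (Dom C f) (Cod C f) (Cod C g) f g h"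
  unfolding dtri_def using dist_triangle unfolding triangle_def Hom_def by auto

lemma dtri_dist:
  assumes "dtri X Y Z f g h"
  shows "(f, g, h) \<in> dist C" "Dom C f = X" "Cod C f = Y" "Dom C g = Y" "Cod C g = Z" "Dom C h = Z"
  using assms unfolding dtri_def Hom_def by auto

lemma ex_cone:
  assumes "f \<in> Hom C X Y"
  obtains Z g h where "dtri X Y Z f g h"
proof -
  obtain g h where "(f, g, h) \<in> dist C" using TR1_cone assms unfolding Hom_def by blast
  then show thesis using that dist_imp_dtri assms unfolding Hom_def by fastforce
qed

lemma shift_Obj: "X \<in> Obj C \<Longrightarrow> shift C X \<in> Obj C"
  using shift_bij bij_betwE by metis

lemma dtri_ident:
  assumes "X \<in> Obj C" "zero_object C Z"
  shows "dtri X X Z (ident C X) (zero_arr C X Z) (zero_arr C Z (shift C X))"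
  unfolding dtri_def
  by (intro conjI TR1_ident[OF assms] ident_closed zero_closed zero_object_Obj shift_Obj assms)

lemma shift_inj: "\<lbrakk>X \<in> Obj C; Y \<in> Obj C; shift C X = shift C Y\<rbrakk> \<Longrightarrow> X = Y"
  using shift_bij unfolding bij_betw_def inj_on_def by blast

lemma shift_surj:
  assumes "Y \<in> Obj C"
  obtains X where "X \<in> Obj C" "Y = shift C X"
  using assms shift_bij unfolding bij_betw_def by blast

lemma shift_arr_full:
  assumes "g \<in> Hom C (shift C X) (shift C Y)" "X \<in> Obj C" "Y \<in> Obj C"
  obtains f where "f \<in> Hom C X Y" "g = shift_arr C f"
proof -
  obtain f where f: "f \<in> Arr C" "g = shift_arr C f"
    using assms(1) shift_arr_bij unfolding bij_betw_def Hom_def by blast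
  then have "f \<in> Hom C (Dom C f) (Cod C f)" unfolding Hom_def by simp
  then have "g \<in> Hom C (shift C (Dom C f)) (shift C (Cod C f))"
    using f shift_arr_hom by blast
  then have "shift C (Dom C f) = shift C X" "shift C (Cod C f) = shift C Y"
    using assms(1) unfolding Hom_def by auto
  then have "f \<in> Hom C X Y"
    using shift_inj f assms Dom_closed Cod_closed unfolding Hom_def by blast
  then show thesis using that f by blast
qed

lemma shift_arr_faithful:
  assumes "f \<in> Hom C X Y" "g \<in> Hom C X' Y'" "shift_arr C f = shift_arr C g"
  shows "f = g"
  using assms shift_arr_bij unfolding bij_betw_def inj_on_def Hom_def by blast

lemma shift_zero:
  assumes "X \<in> Obj C" "Y \<in> Obj C"
  shows "shift_arr C (zero_arr C X Y) = zero_arr C (shift C X) (shift C Y)"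
proof -
  have z: "zero_arr C X Y \<in> Hom C X Y" using assms zero_closed by blast
  have "shift_arr C (zero_arr C X Y) \<oplus> shift_arr C (zero_arr C X Y) = shift_arr C (zero_arr C X Y)"
    using shift_plus[OF z z] plus_zero[OF z] by simp
  then show ?thesis using plus_eq_self shift_arr_hom[OF z] by blast
qed

lemma dtri_rotate:
  assumes "dtri X Y Z f g h"
  shows "dtri Y Z (shift C X) g h (neg_arr C (shift_arr C f))"
  unfolding dtri_def
proof (intro conjI)
  show "neg_arr C (shift_arr C f) \<in> Hom C (shift C X) (shift C Y)"
    using neg_closed shift_arr_hom dtri_Hom[OF assms] by blast
  show "(g, h, neg_arr C (shift_arr C f)) \<in> dist C"
    using TR2 dist_triangle dtri_dist[OF assms] by blast
qed (use dtri_Hom[OF assms] in auto)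

text \<open>\<open>TR2\<close> is an equivalence and the shift is full, so the last arrow is, up to
  sign, the shift of the arrow looked for.\<close>

lemma dtri_unrotate:
  assumes "dtri Y Z (shift C X) g h k" "X \<in> Obj C"
  obtains f where "dtri X Y Z f g h" "k = neg_arr C (shift_arr C f)"
proof -
  have k: "k \<in> Hom C (shift C X) (shift C Y)" using dtri_Hom[OF assms(1)] by blast
  then obtain f where f: "f \<in> Hom C X Y" "neg_arr C k = shift_arr C f"
    using shift_arr_full neg_closed dtri_Obj[OF assms(1)] assms(2) by metis
  then have kf: "k = neg_arr C (shift_arr C f)" using neg_neg[OF k] by simp
  have gh: "g \<in> Hom C Y Z" "h \<in> Hom C Z (shift C X)" using dtri_Hom[OF assms(1)] by auto
  have "triangle C f g h" unfolding triangle_def using f gh unfolding Hom_def by auto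
  then have "(f, g, h) \<in> dist C" using TR2 kf dtri_dist(1)[OF assms(1)] by blast
  then have "dtri X Y Z f g h" unfolding dtri_def using f gh by blast
  then show thesis using that kf by blast
qed

section \<open>Exactness of Hom, comparison of cones, and split triangles\<close>

lemma dtri_morphism:
  assumes "dtri X Y Z f g h" "dtri X' Y' Z' f' g' h'" "a \<in> Hom C X X'" "b \<in> Hom C Y Y'"
    "b \<bullet> f = f' \<bullet> a"
  obtains c where "c \<in> Hom C Z Z'" "c \<bullet> g = g' \<bullet> b" "shift_arr C a \<bullet> h = h' \<bullet> c"
  using TR3[of f g h f' g' h' a b] assms(3-5) that
  by (auto simp: dtri_dist[OF assms(1)] dtri_dist[OF assms(2)])

text \<open>Mapping the identity triangle on \<open>X\<close> to the given one by
  \<open>(1, f)\<close> makes \<open>g f\<close> factor through a zero object; the second equation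
  is the first one for the rotated triangle.\<close>

lemma dtri_comp_zero:
  assumes "dtri X Y Z f g h"
  shows "g \<bullet> f = zero_arr C X Z" "h \<bullet> g = zero_arr C Y (shift C X)"
proof -
  have gen: "g \<bullet> f = zero_arr C X Z" if t: "dtri X Y Z f g h" for X Y Z f g h
  proof -
    obtain O' where O': "zero_object C O'" using ex_zero_object by blast
    have X: "X \<in> Obj C" using dtri_Obj[OF t] by blast
    note f = dtri_Hom(1)[OF t]
    obtain c where c: "c \<in> Hom C O' Z" "c \<bullet> zero_arr C X O' = g \<bullet> f"
      by (rule dtri_morphism[OF dtri_ident[OF X O'] t ident_closed[OF X] f]) auto
    then show ?thesis using comp_zero[OF X c(1)] by simp
  qed
  show "g \<bullet> f = zero_arr C X Z" "h \<bullet> g = zero_arr C Y (shift C X)"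
    using gen assms dtri_rotate by blast+
qed

text \<open>Exactness of \<open>Hom(W, -)\<close>. \<open>TR3\<close> only supplies the third
  component of a morphism of triangles, so the identity triangle on \<open>W\<close> and
  \<open>t\<close> are both rotated once, to make the wanted \<open>W -> X\<close> third, up to a
  shift. The signs from the two rotations cancel.\<close>

lemma dtri_lift:
  assumes t: "dtri X Y Z f g h" and u: "u \<in> Hom C W Y" "g \<bullet> u = zero_arr C W Z"
  obtains v where "v \<in> Hom C W X" "f \<bullet> v = u"
proof -
  obtain O' where O': "zero_object C O'" using ex_zero_object by blast
  have W: "W \<in> Obj C" using u Hom_Obj by blast
  note o = dtri_Obj[OF t] note hm = dtri_Hom[OF t]
  have O'o: "O' \<in> Obj C" using O' zero_object_Obj by blast
  have z: "zero_arr C O' Z \<in> Hom C O' Z" using zero_closed o O'o by blast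
  have eq: "zero_arr C O' Z \<bullet> zero_arr C W O' = g \<bullet> u"
    using comp_zero[OF W z] u by simp
  obtain c where c: "c \<in> Hom C (shift C W) (shift C X)"
    "shift_arr C u \<bullet> neg_arr C (shift_arr C (ident C W)) = neg_arr C (shift_arr C f) \<bullet> c"
    by (rule dtri_morphism[OF dtri_rotate[OF dtri_ident[OF W O']] dtri_rotate[OF t] u(1) z eq]) auto
  obtain v where v: "v \<in> Hom C W X" "c = shift_arr C v"
    using shift_arr_full c W o by blast
  have su: "shift_arr C u \<in> Hom C (shift C W) (shift C Y)" using u shift_arr_hom by blast
  have sf: "shift_arr C f \<in> Hom C (shift C X) (shift C Y)" using hm shift_arr_hom by blast
  have si: "ident C (shift C W) \<in> Hom C (shift C W) (shift C W)"
    using ident_closed W shift_Obj by blast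
  have "neg_arr C (shift_arr C u) = neg_arr C (shift_arr C f \<bullet> c)"
    using c(2) comp_neg[OF si su] neg_comp[OF c(1) sf] shift_ident[OF W] comp_ident[OF su] by simp
  then have "shift_arr C u = shift_arr C f \<bullet> c"
    using neg_neg su sf c comp_closed by metis
  then have "shift_arr C u = shift_arr C (f \<bullet> v)"
    using v shift_comp hm by simp
  then have "f \<bullet> v = u" using shift_arr_faithful u v hm comp_closed by metis
  then show thesis using that v by blast
qed

text \<open>Exactness of \<open>Hom(-, W)\<close>: \<open>t\<close> is mapped to a triangle
  \<open>P -> W -> W\<close> whose first object shifts to a zero object and whose second arrow is
  the identity, by \<open>(0, u)\<close>.\<close>

lemma dtri_extend:
  assumes t: "dtri X Y Z f g h" and u: "u \<in> Hom C Y W" "u \<bullet> f = zero_arr C X W"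
  obtains v where "v \<in> Hom C Z W" "v \<bullet> g = u"
proof -
  obtain O' where O': "zero_object C O'" using ex_zero_object by blast
  then obtain P where P: "P \<in> Obj C" "O' = shift C P" using shift_surj zero_object_Obj by metis
  have W: "W \<in> Obj C" using u Hom_Obj by blast
  obtain k where k: "dtri P W W k (ident C W) (zero_arr C W O')"
    using dtri_unrotate[of W W P "ident C W" "zero_arr C W O'"] dtri_ident[OF W O'] P by metis
  note o = dtri_Obj[OF t]
  have z: "zero_arr C X P \<in> Hom C X P" using zero_closed o P by blast
  have eq: "u \<bullet> f = k \<bullet> zero_arr C X P" using u comp_zero[OF o(1) dtri_Hom(1)[OF k]] by simp
  obtain c where "c \<in> Hom C Z W" "c \<bullet> g = ident C W \<bullet> u"
    by (rule dtri_morphism[OF t k z u(1) eq]) auto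
  then show thesis using that ident_comp[OF u(1)] by simp
qed

text \<open>The error \<open>d = 1 - c\<close> satisfies \<open>d g = 0\<close> and
  \<open>h d = 0\<close>. By the former it factors through \<open>h\<close>, so the latter gives
  \<open>d d = 0\<close>, and \<open>1 + d\<close> inverts \<open>c\<close>.\<close>

lemma dtri_five:
  assumes t: "dtri X Y Z f g h" and c: "c \<in> Hom C Z Z" "c \<bullet> g = g" "h \<bullet> c = h"
  obtains c' where "c' \<in> Hom C Z Z" "c' \<bullet> c = ident C Z" "c \<bullet> c' = ident C Z"
proof -
  note o = dtri_Obj[OF t] note hm = dtri_Hom[OF t]
  have i: "ident C Z \<in> Hom C Z Z" using ident_closed o by blast
  obtain d where d: "d \<in> Hom C Z Z" "c \<oplus> d = ident C Z" using ex_diff[OF c(1) i] by blast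
  have "g \<oplus> (d \<bullet> g) = g"
    using plus_comp[OF hm(2) c(1) d(1)] c(2) d(2) ident_comp[OF hm(2)] by simp
  then have dg: "d \<bullet> g = zero_arr C Y Z" using plus_eq_self hm d comp_closed by blast
  have "h \<oplus> (h \<bullet> d) = h"
    using comp_plus[OF c(1) d(1) hm(3)] c(3) d(2) comp_ident[OF hm(3)] by simp
  then have hd: "h \<bullet> d = zero_arr C Z (shift C X)" using plus_eq_self hm d comp_closed by blast
  obtain v where v: "v \<in> Hom C (shift C X) Z" "v \<bullet> h = d"
    using dtri_extend[OF dtri_rotate[OF t] d(1) dg] by blast
  have dd: "d \<bullet> d = zero_arr C Z Z"
    using comp_assoc[OF d(1) hm(3) v(1)] v(2) hd comp_zero[OF o(3) v(1)] by simp
  have dc: "d \<bullet> c = d"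
    using comp_plus[OF c(1) d(1) d(1)] d(2) dd comp_ident[OF d(1)] plus_zero
      comp_closed[OF c(1) d(1)] by simp
  have cd: "c \<bullet> d = d"
    using plus_comp[OF d(1) c(1) d(1)] d(2) dd ident_comp[OF d(1)] plus_zero
      comp_closed[OF d(1) c(1)] by simp
  have "(ident C Z \<oplus> d) \<bullet> c = ident C Z"
    using plus_comp[OF c(1) i d(1)] ident_comp[OF c(1)] dc d(2) by simp
  moreover have "c \<bullet> (ident C Z \<oplus> d) = ident C Z"
    using comp_plus[OF i d(1) c(1)] comp_ident[OF c(1)] cd d(2) by simp
  ultimately show thesis using that plus_closed[OF i d(1)] by blast
qed

text \<open>Cones are not functorial: the induced \<open>a\<close> and \<open>b\<close> need not
  satisfy \<open>b a = 1\<close>. But \<open>b a\<close> is compatible with \<open>g\<close> and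
  \<open>h\<close>, hence invertible by \<open>dtri_five\<close>, and its inverse corrects the
  retraction \<open>b\<close>.\<close>

lemma cone_retract:
  assumes t: "dtri X Y Z f g h" and t': "dtri X Y' Z' f' g' h'"
    and i: "i \<in> Hom C Y Y'" "i \<bullet> f = f'" and p: "p \<in> Hom C Y' Y" "p \<bullet> i = ident C Y"
  shows "retract_of C Z Z'"
proof -
  note o = dtri_Obj[OF t] note hm = dtri_Hom[OF t] note o' = dtri_Obj[OF t'] note hm' = dtri_Hom[OF t']
  have id: "ident C X \<in> Hom C X X" using ident_closed o by blast
  have pf: "p \<bullet> f' = f" using comp_assoc[OF hm(1) i(1) p(1)] i p ident_comp[OF hm(1)] by simp
  obtain a where a: "a \<in> Hom C Z Z'" "a \<bullet> g = g' \<bullet> i" "shift_arr C (ident C X) \<bullet> h = h' \<bullet> a"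
    by (rule dtri_morphism[OF t t' id i(1)]) (use i comp_ident[OF hm'(1)] in auto)
  obtain b where b: "b \<in> Hom C Z' Z" "b \<bullet> g' = g \<bullet> p" "shift_arr C (ident C X) \<bullet> h' = h \<bullet> b"
    by (rule dtri_morphism[OF t' t id p(1)]) (use pf comp_ident[OF hm(1)] in auto)
  have ba: "b \<bullet> a \<in> Hom C Z Z" using a b comp_closed by blast
  have ha: "h' \<bullet> a = h" using a(3) shift_ident[OF o(1)] ident_comp[OF hm(3)] by simp
  have hb: "h \<bullet> b = h'" using b(3) shift_ident[OF o(1)] ident_comp[OF hm'(3)] by simp
  have "(b \<bullet> a) \<bullet> g = b \<bullet> (g' \<bullet> i)" using comp_assoc[OF hm(2) a(1) b(1)] a(2) by simp
  also have "\<dots> = (g \<bullet> p) \<bullet> i" using comp_assoc[OF i(1) hm'(2) b(1)] b(2) by simp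
  also have "\<dots> = g" using comp_assoc[OF i(1) p(1) hm(2)] p(2) comp_ident[OF hm(2)] by simp
  finally have bag: "(b \<bullet> a) \<bullet> g = g" .
  have hba: "h \<bullet> (b \<bullet> a) = h" using comp_assoc[OF a(1) b(1) hm(3)] ha hb by simp
  obtain c where c: "c \<in> Hom C Z Z" "c \<bullet> (b \<bullet> a) = ident C Z"
    using dtri_five[OF t ba bag hba] by blast
  then have "(c \<bullet> b) \<bullet> a = ident C Z" using comp_assoc[OF a(1) b(1) c(1)] by simp
  then show ?thesis unfolding retract_of_def using a b c comp_closed by blast
qed

lemma cone_isomorphic:
  assumes t: "dtri X Y Z f g h" and t': "dtri X Y Z' f g' h'"
  shows "isomorphic C Z Z'"
proof -
  note o = dtri_Obj[OF t] note hm = dtri_Hom[OF t] note o' = dtri_Obj[OF t'] note hm' = dtri_Hom[OF t']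
  have id: "ident C X \<in> Hom C X X" "ident C Y \<in> Hom C Y Y" using ident_closed o by blast+
  have eq: "ident C Y \<bullet> f = f \<bullet> ident C X" using ident_comp[OF hm(1)] comp_ident[OF hm(1)] by simp
  obtain a where a: "a \<in> Hom C Z Z'" "a \<bullet> g = g' \<bullet> ident C Y" "shift_arr C (ident C X) \<bullet> h = h' \<bullet> a"
    by (rule dtri_morphism[OF t t' id eq])
  obtain b where b: "b \<in> Hom C Z' Z" "b \<bullet> g' = g \<bullet> ident C Y" "shift_arr C (ident C X) \<bullet> h' = h \<bullet> b"
    by (rule dtri_morphism[OF t' t id eq])
  have ag: "a \<bullet> g = g'" using a comp_ident[OF hm'(2)] by simp
  have bg: "b \<bullet> g' = g" using b comp_ident[OF hm(2)] by simp
  have ha: "h' \<bullet> a = h" using a(3) shift_ident[OF o(1)] ident_comp[OF hm(3)] by simp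
  have hb: "h \<bullet> b = h'" using b(3) shift_ident[OF o(1)] ident_comp[OF hm'(3)] by simp
  have ba: "b \<bullet> a \<in> Hom C Z Z" and ab: "a \<bullet> b \<in> Hom C Z' Z'" using a b comp_closed by blast+
  obtain c where c: "c \<in> Hom C Z Z" "c \<bullet> (b \<bullet> a) = ident C Z"
    by (rule dtri_five[OF t ba])
      (use comp_assoc[OF hm(2) a(1) b(1)] comp_assoc[OF a(1) b(1) hm(3)] ag bg ha hb in auto)
  obtain d where d: "d \<in> Hom C Z' Z'" "(a \<bullet> b) \<bullet> d = ident C Z'"
    by (rule dtri_five[OF t' ab])
      (use comp_assoc[OF hm'(2) b(1) a(1)] comp_assoc[OF b(1) a(1) hm'(3)] ag bg ha hb in auto)
  have cb: "c \<bullet> b \<in> Hom C Z' Z" and bd: "b \<bullet> d \<in> Hom C Z' Z" using b c d comp_closed by blast+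
  have l: "(c \<bullet> b) \<bullet> a = ident C Z" using c comp_assoc[OF a(1) b(1) c(1)] by simp
  have r: "a \<bullet> (b \<bullet> d) = ident C Z'" using d comp_assoc[OF d(1) b(1) a(1)] by simp
  have "c \<bullet> b = b \<bullet> d"
    using comp_assoc[OF bd a(1) cb] l r comp_ident[OF cb] ident_comp[OF bd] by simp
  then have "iso_arrow C a Z Z'" unfolding iso_arrow_def using a(1) cb l r by metis
  then show ?thesis unfolding isomorphic_def by blast
qed

text \<open>Since \<open>h\<close> vanishes, the identity of \<open>Z\<close> lifts to a section
  \<open>s\<close>; then \<open>1 - s g\<close> is killed by \<open>g\<close> and so has the form
  \<open>f p\<close>. The remaining equations follow by cancelling \<open>f\<close>.\<close>

lemma dtri_split:
  assumes t: "dtri X Y Z f g h" and h: "h = zero_arr C Z (shift C X)"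
  obtains s p where "s \<in> Hom C Z Y" "p \<in> Hom C Y X" "g \<bullet> s = ident C Z" "p \<bullet> f = ident C X"
    "(f \<bullet> p) \<oplus> (s \<bullet> g) = ident C Y" "p \<bullet> s = zero_arr C Z X"
proof -
  note o = dtri_Obj[OF t] note hm = dtri_Hom[OF t]
  have id: "ident C Z \<in> Hom C Z Z" "ident C Y \<in> Hom C Y Y" "ident C X \<in> Hom C X X"
    using ident_closed o by blast+
  have "h \<bullet> ident C Z = zero_arr C Z (shift C X)" using h comp_ident hm by metis
  then obtain s where s: "s \<in> Hom C Z Y" "g \<bullet> s = ident C Z"
    using dtri_lift[OF dtri_rotate[OF t] id(1)] by blast
  \<comment> \<open>\<open>f\<close> is monic: the shift of an arrow killed by \<open>f\<close>
    lifts through \<open>h\<close>, which is zero.\<close>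
  have f_mono: "v = zero_arr C W X" if v: "v \<in> Hom C W X" "f \<bullet> v = zero_arr C W Y" for v W
  proof -
    have W: "W \<in> Obj C" using v Hom_Obj by blast
    have sv: "shift_arr C v \<in> Hom C (shift C W) (shift C X)" using v shift_arr_hom by blast
    have sf: "shift_arr C f \<in> Hom C (shift C X) (shift C Y)" using hm shift_arr_hom by blast
    have "shift_arr C f \<bullet> shift_arr C v = zero_arr C (shift C W) (shift C Y)"
      using shift_comp[OF v(1) hm(1)] v(2) shift_zero W o by simp
    then have "neg_arr C (shift_arr C f) \<bullet> shift_arr C v = zero_arr C (shift C W) (shift C Y)"
      using neg_comp[OF sv sf] neg_unique plus_zero zero_closed W o shift_Obj by metis
    then obtain w where w: "w \<in> Hom C (shift C W) Z" "h \<bullet> w = shift_arr C v"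
      using dtri_lift[OF dtri_rotate[OF dtri_rotate[OF t]] sv] by blast
    then have "shift_arr C v = shift_arr C (zero_arr C W X)"
      using h zero_comp[OF _ w(1)] shift_zero W o shift_Obj by metis
    then show ?thesis using shift_arr_faithful v zero_closed W o by metis
  qed
  have sg: "s \<bullet> g \<in> Hom C Y Y" using s hm comp_closed by blast
  obtain d where d: "d \<in> Hom C Y Y" "(s \<bullet> g) \<oplus> d = ident C Y"
    using ex_diff[OF sg id(2)] by blast
  have "g \<bullet> (s \<bullet> g) = g" using comp_assoc[OF hm(2) s(1) hm(2)] s(2) ident_comp[OF hm(2)] by simp
  then have "g \<oplus> (g \<bullet> d) = g"
    using comp_plus[OF sg d(1) hm(2)] d(2) comp_ident[OF hm(2)] by simp
  then have "g \<bullet> d = zero_arr C Y Z" using plus_eq_self hm d comp_closed by blast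
  then obtain p where p: "p \<in> Hom C Y X" "f \<bullet> p = d" using dtri_lift[OF t d(1)] by blast
  have sum: "(f \<bullet> p) \<oplus> (s \<bullet> g) = ident C Y" using d p plus_commute[OF d(1) sg] by simp
  have fp: "f \<bullet> p \<in> Hom C Y Y" using d p by simp
  have pf: "p \<bullet> f \<in> Hom C X X" using p hm comp_closed by blast
  obtain e where e: "e \<in> Hom C X X" "(p \<bullet> f) \<oplus> e = ident C X" using ex_diff[OF pf id(3)] by blast
  have "(s \<bullet> g) \<bullet> f = zero_arr C X Y"
    using comp_assoc[OF hm(1,2) s(1)] dtri_comp_zero[OF t] comp_zero[OF o(1) s(1)] by simp
  then have "(f \<bullet> p) \<bullet> f = f"
    using plus_comp[OF hm(1) fp sg] sum ident_comp[OF hm(1)] plus_zero comp_closed[OF hm(1) fp]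
    by simp
  then have "f \<bullet> (p \<bullet> f) = f" using comp_assoc[OF hm(1) p(1) hm(1)] by simp
  then have "f \<oplus> (f \<bullet> e) = f"
    using comp_plus[OF pf e(1) hm(1)] e(2) comp_ident[OF hm(1)] by simp
  then have "e = zero_arr C X X" using f_mono e plus_eq_self hm comp_closed by blast
  then have pf1: "p \<bullet> f = ident C X" using e plus_zero pf by simp
  have ps: "p \<bullet> s \<in> Hom C Z X" using p s comp_closed by blast
  have fps: "f \<bullet> (p \<bullet> s) \<in> Hom C Z Y" using ps hm comp_closed by blast
  have "(s \<bullet> g) \<bullet> s = s" using comp_assoc[OF s(1) hm(2) s(1)] s(2) comp_ident[OF s(1)] by simp
  then have "(f \<bullet> (p \<bullet> s)) \<oplus> s = s"
    using plus_comp[OF s(1) fp sg] sum ident_comp[OF s(1)] comp_assoc[OF s(1) p(1) hm(1)] by simp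
  then have "f \<bullet> (p \<bullet> s) = zero_arr C Z Y"
    using plus_eq_self[OF s(1) fps] plus_commute[OF s(1) fps] by simp
  then have "p \<bullet> s = zero_arr C Z X" using f_mono ps by blast
  then show thesis using that s p sum pf1 by blast
qed


section \<open>Shifting triangles, cocones, and triangles with a zero term\<close>

lemma dtri_shift:
  assumes "dtri X Y Z f g h"
  obtains f' g' h' where "dtri (shift C X) (shift C Y) (shift C Z) f' g' h'"
  \<comment> \<open>Three rotations shift all three objects; the signs acquired are absorbed into
    the existentially chosen arrows.\<close>
  using dtri_rotate[OF dtri_rotate[OF dtri_rotate[OF assms]]] that by blast

lemma dtri_unshift:
  assumes t: "dtri (shift C X) (shift C Y) (shift C Z) f g h"
    and o: "X \<in> Obj C" "Y \<in> Obj C" "Z \<in> Obj C"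
  obtains f' g' h' where "dtri X Y Z f' g' h'"
proof -
  obtain a where a: "dtri Z (shift C X) (shift C Y) a f g" using dtri_unrotate[OF t o(3)] by blast
  obtain b where b: "dtri Y Z (shift C X) b a f" using dtri_unrotate[OF a o(2)] by blast
  obtain c where "dtri X Y Z c b a" using dtri_unrotate[OF b o(1)] by blast
  then show thesis using that by blast
qed

lemma ex_cocone:
  assumes "g \<in> Hom C Y Z"
  obtains X f h where "dtri X Y Z f g h"
proof -
  obtain W h k where t: "dtri Y Z W g h k" using ex_cone[OF assms] by blast
  obtain X where X: "X \<in> Obj C" "W = shift C X" using shift_surj dtri_Obj(3)[OF t] by blast
  obtain f where "dtri X Y Z f g h" using dtri_unrotate t X by blast
  then show thesis using that by blast
qed

text \<open>The identity triangle on \<open>X\<close> carried along \<open>(1, f, 1)\<close>. It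
  presents \<open>Y\<close> as an extension of a zero object by \<open>X\<close>, which is why
  extension-closed classes are closed under isomorphism.\<close>

lemma dtri_iso:
  assumes f: "iso_arrow C f X Y" and Z: "zero_object C Z"
  shows "dtri X Y Z f (zero_arr C Y Z) (zero_arr C Z (shift C X))"
proof -
  have fh: "f \<in> Hom C X Y" using f unfolding iso_arrow_def by blast
  note X = Hom_Obj(1)[OF fh] note Y = Hom_Obj(2)[OF fh] note Zo = zero_object_Obj[OF Z]
  note SX = shift_Obj[OF X]
  have iX: "iso_arrow C (ident C X) X X" and iZ: "iso_arrow C (ident C Z) Z Z"
    unfolding iso_arrow_def using ident_closed ident_comp X Zo by blast+
  note t = dtri_ident[OF X Z]
  note z = zero_closed[OF Y Zo] zero_closed[OF Zo SX] zero_closed[OF X Zo]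
  have dc: "Dom C f = X" "Cod C f = Y" "Dom C (zero_arr C Y Z) = Y" "Cod C (zero_arr C Y Z) = Z"
    "Dom C (zero_arr C Z (shift C X)) = Z" "Cod C (zero_arr C Z (shift C X)) = shift C X"
    "f \<in> Arr C" "zero_arr C Y Z \<in> Arr C" "zero_arr C Z (shift C X) \<in> Arr C"
    using fh z unfolding Hom_def by auto
  have tr: "triangle C f (zero_arr C Y Z) (zero_arr C Z (shift C X))"
    unfolding triangle_def using dc by simp
  have "(f, zero_arr C Y Z, zero_arr C Z (shift C X)) \<in> dist C"
  proof (rule TR1_iso[OF dtri_dist(1)[OF t] tr])
    show "iso_arrow C (ident C X) (Dom C (ident C X)) (Dom C f)" using iX dtri_dist[OF t] dc by simp
    show "iso_arrow C f (Dom C (zero_arr C X Z)) (Dom C (zero_arr C Y Z))"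
      using f dtri_dist[OF t] dc by simp
    show "iso_arrow C (ident C Z) (Dom C (zero_arr C Z (shift C X))) (Dom C (zero_arr C Z (shift C X)))"
      using iZ dc by simp
    show "ident C Z \<bullet> zero_arr C X Z = zero_arr C Y Z \<bullet> f"
      using ident_comp[OF z(3)] zero_comp[OF Zo fh] by simp
    show "shift_arr C (ident C X) \<bullet> zero_arr C Z (shift C X) = zero_arr C Z (shift C X) \<bullet> ident C Z"
      using shift_ident[OF X] ident_comp[OF z(2)] comp_ident[OF z(2)] by simp
  qed simp
  then show ?thesis unfolding dtri_def using fh z by blast
qed

text \<open>In the triangle completing the identity on the left, \<open>h = h 1\<close> and
  \<open>k = 1 k\<close> are composites of consecutive arrows, hence zero. So the triangle splits,
  and the identity of \<open>P\<close> is \<open>p k = 0\<close>.\<close>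

lemma dtri_zero_ident:
  assumes "W \<in> Obj C"
  obtains P k h where "zero_object C P" "dtri P W W k (ident C W) h"
proof -
  obtain P k h where t: "dtri P W W k (ident C W) h" using ex_cocone ident_closed[OF assms] by blast
  note o = dtri_Obj[OF t] note hm = dtri_Hom[OF t]
  have h: "h = zero_arr C W (shift C P)"
    using dtri_comp_zero(2)[OF t] comp_ident[OF hm(3)] by simp
  obtain s p where sp: "p \<in> Hom C W P" "p \<bullet> k = ident C P"
    using dtri_split[OF t h] by blast
  have "k = zero_arr C P W" using dtri_comp_zero(1)[OF t] ident_comp[OF hm(1)] by simp
  then have "ident C P = zero_arr C P P" using sp comp_zero[OF o(1) sp(1)] by simp
  then show thesis using that t o zero_object_iff by blast
qed

section \<open>Extension-closed classes\<close>

lemma extension_closed_iff: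
  "extension_closed C D \<longleftrightarrow> D \<subseteq> Obj C \<and> (\<forall>Z. zero_object C Z \<longrightarrow> Z \<in> D) \<and>
    (\<forall>X Y Z f g h. dtri X Y Z f g h \<longrightarrow> X \<in> D \<longrightarrow> Z \<in> D \<longrightarrow> Y \<in> D)"
proof -
  have "(\<forall>f g h. (f, g, h) \<in> dist C \<and> Dom C f \<in> D \<and> Cod C g \<in> D \<longrightarrow> Cod C f \<in> D) \<longleftrightarrow>
    (\<forall>X Y Z f g h. dtri X Y Z f g h \<longrightarrow> X \<in> D \<longrightarrow> Z \<in> D \<longrightarrow> Y \<in> D)" (is "?l = ?r")
  proof
    assume ?l then show ?r using dtri_dist by metis
  next
    assume ?r then show ?l using dist_imp_dtri by blast
  qed
  then show ?thesis unfolding extension_closed_def by blast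
qed

lemma extension_closedD:
  assumes "extension_closed C D"
  shows "D \<subseteq> Obj C" "zero_object C Z \<Longrightarrow> Z \<in> D"
    "\<lbrakk>dtri X Y Z f g h; X \<in> D; Z \<in> D\<rbrakk> \<Longrightarrow> Y \<in> D"
  using assms unfolding extension_closed_iff by blast+

lemma extension_closed_Obj: "extension_closed C (Obj C)"
  unfolding extension_closed_iff using dtri_Obj zero_object_Obj by blast

lemma extension_closed_imp_iso_closed:
  assumes "extension_closed C D"
  shows "iso_closed C D"
  unfolding iso_closed_def
proof (intro conjI ballI impI)
  show "D \<subseteq> Obj C" using assms extension_closedD by blast
  fix Y X assume Y: "Y \<in> D" and "isomorphic C X Y"
  then obtain f g where "f \<in> Hom C X Y" "g \<in> Hom C Y X" "g \<bullet> f = ident C X" "f \<bullet> g = ident C Y"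
    unfolding isomorphic_def iso_arrow_def by blast
  then have "iso_arrow C g Y X" unfolding iso_arrow_def by blast
  moreover obtain Z where "zero_object C Z" using ex_zero_object by blast
  ultimately show "X \<in> D" using dtri_iso extension_closedD(2,3)[OF assms] Y by blast
qed

lemma extension_closed_Inter:
  assumes "S \<noteq> {}" "\<And>D. D \<in> S \<Longrightarrow> extension_closed C D"
  shows "extension_closed C (\<Inter>S)"
  unfolding extension_closed_iff
proof (intro conjI allI impI)
  show "\<Inter>S \<subseteq> Obj C" using assms extension_closedD(1) by blast
  show "Z \<in> \<Inter>S" if "zero_object C Z" for Z using that assms extension_closedD(2) by blast
  show "Y \<in> \<Inter>S" if "dtri X Y Z f g h" "X \<in> \<Inter>S" "Z \<in> \<Inter>S" for X Y Z f g h
    using that assms extension_closedD(3) by blast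
qed

lemma subset_extension_closure: "D \<subseteq> extension_closure C D"
  unfolding extension_closure_def by blast

lemma extension_closure_least:
  "\<lbrakk>extension_closed C E; D \<subseteq> E\<rbrakk> \<Longrightarrow> extension_closure C D \<subseteq> E"
  unfolding extension_closure_def by blast

lemma extension_closed_extension_closure:
  assumes "D \<subseteq> Obj C"
  shows "extension_closed C (extension_closure C D)"
  unfolding extension_closure_def
  by (rule extension_closed_Inter) (use assms extension_closed_Obj in auto)

lemma extension_closure_mono: "D \<subseteq> E \<Longrightarrow> extension_closure C D \<subseteq> extension_closure C E"
  unfolding extension_closure_def by blast

lemma extension_closure_eq: "extension_closed C D \<Longrightarrow> extension_closure C D = D"
  unfolding extension_closure_def by blast

lemma subset_envelope: "D \<subseteq> envelope C D"
  unfolding envelope_def by blast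

lemma envelope_least:
  "\<lbrakk>extension_closed C E; retraction_closed C E; D \<subseteq> E\<rbrakk> \<Longrightarrow> envelope C D \<subseteq> E"
  unfolding envelope_def by blast

lemma retraction_closed_Obj: "retraction_closed C (Obj C)"
  unfolding retraction_closed_def by blast

lemma envelope_closed:
  assumes "D \<subseteq> Obj C"
  shows "extension_closed C (envelope C D)" "retraction_closed C (envelope C D)"
proof -
  show "extension_closed C (envelope C D)" unfolding envelope_def
    by (rule extension_closed_Inter) (use assms extension_closed_Obj retraction_closed_Obj in auto)
  show "retraction_closed C (envelope C D)"
    unfolding retraction_closed_def[of _ "envelope C D"]
  proof (intro conjI ballI impI)
    show "envelope C D \<subseteq> Obj C"
      using assms envelope_least extension_closed_Obj retraction_closed_Obj by blast
    fix Y X assume "Y \<in> envelope C D" "X \<in> Obj C" "retract_of C X Y"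
    then show "X \<in> envelope C D" unfolding envelope_def retraction_closed_def by blast
  qed
qed

subsection \<open>Orthogonality\<close>

lemma perp_extension_left:
  assumes t: "dtri X Y Z f g h" and p: "perp C {X} E" "perp C {Z} E" and E: "E \<subseteq> Obj C"
  shows "perp C {Y} E"
proof -
  note o = dtri_Obj[OF t] note hm = dtri_Hom[OF t]
  have "u = zero_arr C Y W" if W: "W \<in> E" and u: "u \<in> Hom C Y W" for u W
  proof -
    have "u \<bullet> f = zero_arr C X W" using p(1) W u hm comp_closed unfolding perp_def by blast
    then obtain v where v: "v \<in> Hom C Z W" "v \<bullet> g = u" using dtri_extend[OF t u] by blast
    then have "v = zero_arr C Z W" using p(2) W unfolding perp_def by blast
    then show ?thesis using v zero_comp[OF _ hm(2)] W E by blast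
  qed
  then show ?thesis unfolding perp_def by blast
qed

lemma perp_extension_right:
  assumes t: "dtri X Y Z f g h" and p: "perp C E {X}" "perp C E {Z}" and E: "E \<subseteq> Obj C"
  shows "perp C E {Y}"
proof -
  note o = dtri_Obj[OF t] note hm = dtri_Hom[OF t]
  have "u = zero_arr C W Y" if W: "W \<in> E" and u: "u \<in> Hom C W Y" for u W
  proof -
    have "g \<bullet> u = zero_arr C W Z" using p(2) W u hm comp_closed unfolding perp_def by blast
    then obtain v where v: "v \<in> Hom C W X" "f \<bullet> v = u" using dtri_lift[OF t u] by blast
    then have "v = zero_arr C W X" using p(1) W unfolding perp_def by blast
    then show ?thesis using v comp_zero[OF _ hm(1)] W E by blast
  qed
  then show ?thesis unfolding perp_def by blast
qed

lemma extension_closed_left_perp: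
  assumes "E \<subseteq> Obj C"
  shows "extension_closed C {X \<in> Obj C. perp C {X} E}"
  unfolding extension_closed_iff
proof (intro conjI allI impI)
  show "Z \<in> {X \<in> Obj C. perp C {X} E}" if "zero_object C Z" for Z
    using zero_object_Obj[OF that] zero_object_Hom_from[OF that] unfolding perp_def by blast
  show "Y \<in> {X \<in> Obj C. perp C {X} E}"
    if "dtri X Y Z f g h" "X \<in> {X \<in> Obj C. perp C {X} E}" "Z \<in> {X \<in> Obj C. perp C {X} E}"
    for X Y Z f g h
    using that(2,3) perp_extension_left[OF that(1) _ _ assms] dtri_Obj[OF that(1)] by simp
qed simp

lemma extension_closed_right_perp:
  assumes "E \<subseteq> Obj C"
  shows "extension_closed C {X \<in> Obj C. perp C E {X}}"
  unfolding extension_closed_iff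
proof (intro conjI allI impI)
  show "Z \<in> {X \<in> Obj C. perp C E {X}}" if "zero_object C Z" for Z
    using zero_object_Obj[OF that] zero_object_Hom_to[OF that] unfolding perp_def by blast
  show "Y \<in> {X \<in> Obj C. perp C E {X}}"
    if "dtri X Y Z f g h" "X \<in> {X \<in> Obj C. perp C E {X}}" "Z \<in> {X \<in> Obj C. perp C E {X}}"
    for X Y Z f g h
    using that(2,3) perp_extension_right[OF that(1) _ _ assms] dtri_Obj[OF that(1)] by simp
qed simp

text \<open>Orthogonals on either side are extension-closed, so one side at a time can be enlarged
  from generators to the whole closure.\<close>

lemma perp_extension_closure:
  assumes "perp C D E" "D \<subseteq> Obj C" "E \<subseteq> Obj C"
  shows "perp C (extension_closure C D) (extension_closure C E)"
proof -
  let ?D = "extension_closure C D"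
  have "?D \<subseteq> {X \<in> Obj C. perp C {X} E}"
    by (rule extension_closure_least[OF extension_closed_left_perp[OF assms(3)]])
      (use assms in \<open>auto simp: perp_def\<close>)
  then have p: "perp C ?D E" and o: "?D \<subseteq> Obj C" unfolding perp_def by blast+
  have "extension_closure C E \<subseteq> {X \<in> Obj C. perp C ?D {X}}"
    by (rule extension_closure_least[OF extension_closed_right_perp[OF o]])
      (use assms p in \<open>auto simp: perp_def\<close>)
  then show ?thesis unfolding perp_def by blast
qed

subsection \<open>Classes of extensions\<close>

text \<open>The usual product \<open>D * E\<close> of classes in a triangulated category, with the
  first term of the triangle taken from \<open>D\<close>.\<close>

definition star :: "'o set \<Rightarrow> 'o set \<Rightarrow> 'o set" where
  "star D E = {M. \<exists>X \<in> D. \<exists>Z \<in> E. \<exists>f g h. dtri X M Z f g h}"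

lemma starI: "\<lbrakk>dtri X M Z f g h; X \<in> D; Z \<in> E\<rbrakk> \<Longrightarrow> M \<in> star D E"
  unfolding star_def by blast

lemma starE:
  assumes "M \<in> star D E"
  obtains X Z f g h where "dtri X M Z f g h" "X \<in> D" "Z \<in> E"
  using assms unfolding star_def by blast

lemma star_mono: "\<lbrakk>D \<subseteq> D'; E \<subseteq> E'\<rbrakk> \<Longrightarrow> star D E \<subseteq> star D' E'"
  unfolding star_def by blast

text \<open>Octahedral axiom for \<open>X -> N -> M\<close>: the cone \<open>Q\<close> of the
  composite is an extension of \<open>Z\<close> by \<open>Y\<close>.\<close>

lemma star_assoc_right: "star (star A B) D \<subseteq> star A (star B D)"
proof
  fix M assume "M \<in> star (star A B) D"
  then obtain N Z g g1 g2 where t: "dtri N M Z g g1 g2" and N: "N \<in> star A B" and Z: "Z \<in> D"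
    by (rule starE)
  obtain X Y f f1 f2 where s: "dtri X N Y f f1 f2" and X: "X \<in> A" and Y: "Y \<in> B"
    using N by (rule starE)
  obtain Q k1 k2 where q: "dtri X M Q (g \<bullet> f) k1 k2"
    using ex_cone[OF comp_closed[OF dtri_Hom(1)[OF s] dtri_Hom(1)[OF t]]] by blast
  obtain a b where ab: "a \<in> Hom C Y Q" "b \<in> Hom C Q Z" "(a, b, shift_arr C f1 \<bullet> g2) \<in> dist C"
    using TR4[OF dtri_Hom(1)[OF s] dtri_Hom(1)[OF t] dtri_dist(1)[OF s] dtri_dist(1)[OF t]
        dtri_dist(1)[OF q]] dtri_dist(5)[OF s] dtri_dist(5)[OF t] dtri_dist(5)[OF q] by auto
  have "shift_arr C f1 \<bullet> g2 \<in> Hom C Z (shift C Y)"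
    by (rule comp_closed[OF dtri_Hom(3)[OF t] shift_arr_hom[OF dtri_Hom(2)[OF s]]])
  then have "dtri Y Q Z a b (shift_arr C f1 \<bullet> g2)" unfolding dtri_def using ab by blast
  then show "M \<in> star A (star B D)" using starI[OF q X starI[OF _ Y Z]] by blast
qed

text \<open>Octahedral axiom for \<open>M -> Q -> Z\<close>. The three cones are
  \<open>X[1]\<close>, \<open>Y[1]\<close> and \<open>N[1]\<close>, with \<open>N\<close> the cocone
  of the composite, so the resulting triangle has to be shifted back.\<close>

lemma star_assoc_left: "star A (star B D) \<subseteq> star (star A B) D"
proof
  fix M assume "M \<in> star A (star B D)"
  then obtain X Q f f1 f2 where t: "dtri X M Q f f1 f2" and X: "X \<in> A" and Q: "Q \<in> star B D"
    by (rule starE)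
  obtain Y Z g g1 g2 where s: "dtri Y Q Z g g1 g2" and Y: "Y \<in> B" and Z: "Z \<in> D"
    using Q by (rule starE)
  note rt = dtri_rotate[OF t] note rs = dtri_rotate[OF s]
  obtain N k k1 where n: "dtri N M Z k (g1 \<bullet> f1) k1"
    using ex_cocone[OF comp_closed[OF dtri_Hom(2)[OF t] dtri_Hom(2)[OF s]]] by blast
  note rn = dtri_rotate[OF n]
  obtain a b where ab: "a \<in> Hom C (shift C X) (shift C N)" "b \<in> Hom C (shift C N) (shift C Y)"
    "(a, b, shift_arr C f2 \<bullet> neg_arr C (shift_arr C g)) \<in> dist C"
    using TR4[OF dtri_Hom(1)[OF rt] dtri_Hom(1)[OF rs] dtri_dist(1)[OF rt] dtri_dist(1)[OF rs]
        dtri_dist(1)[OF rn]] dtri_dist(5)[OF rs] dtri_dist(5)[OF rt] dtri_dist(5)[OF rn] by auto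
  have "shift_arr C f2 \<bullet> neg_arr C (shift_arr C g) \<in> Hom C (shift C Y) (shift C (shift C X))"
    by (rule comp_closed[OF dtri_Hom(3)[OF rs] shift_arr_hom[OF dtri_Hom(3)[OF t]]])
  then have "dtri (shift C X) (shift C N) (shift C Y) a b (shift_arr C f2 \<bullet> neg_arr C (shift_arr C g))"
    unfolding dtri_def using ab by blast
  then obtain u v w where "dtri X N Y u v w"
    using dtri_unshift[OF _ dtri_Obj(1)[OF t] dtri_Obj(1)[OF n] dtri_Obj(1)[OF s]] by blast
  then show "M \<in> star (star A B) D" using starI[OF n starI[OF _ X Y] Z] by blast
qed

lemma star_subset: "extension_closed C D \<Longrightarrow> star D D \<subseteq> D"
  unfolding star_def using extension_closedD(3) by blast

lemma subset_star:
  assumes "extension_closed C D" "extension_closed C E"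
  shows "D \<subseteq> star D E" "E \<subseteq> star D E"
proof
  fix X assume X: "X \<in> D"
  obtain Z where "zero_object C Z" using ex_zero_object by blast
  then show "X \<in> star D E"
    using starI dtri_ident X extension_closedD(1)[OF assms(1)] extension_closedD(2)[OF assms(2)]
    by blast
next
  show "E \<subseteq> star D E"
  proof
    fix X assume X: "X \<in> E"
    then have "X \<in> Obj C" using extension_closedD(1)[OF assms(2)] by blast
    then obtain P k h where "zero_object C P" "dtri P X X k (ident C X) h"
      by (rule dtri_zero_ident)
    then show "X \<in> star D E" using starI X extension_closedD(2)[OF assms(1)] by blast
  qed
qed

text \<open>Under the orthogonality assumption an extension of \<open>Z\<close> by \<open>X\<close> splits, so that the two outer
  terms may be interchanged.\<close>

lemma star_swap:
  assumes p: "perp C D (shift C ` E)" and E: "extension_closed C E"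
  shows "star E D \<subseteq> star D E"
proof
  fix M assume "M \<in> star E D"
  then obtain X Z f g h where t: "dtri X M Z f g h" and X: "X \<in> E" and Z: "Z \<in> D"
    by (rule starE)
  note o = dtri_Obj[OF t] note hm = dtri_Hom[OF t]
  have "h = zero_arr C Z (shift C X)" using p X Z hm(3) unfolding perp_def by blast
  then obtain s r where s: "s \<in> Hom C Z M" "g \<bullet> s = ident C Z" and r: "r \<in> Hom C M X"
    "r \<bullet> f = ident C X" and sum: "(f \<bullet> r) \<oplus> (s \<bullet> g) = ident C M" and rs: "r \<bullet> s = zero_arr C Z X"
    using dtri_split[OF t] by metis
  \<comment> \<open>\<open>Q\<close>, the cone of the section \<open>s\<close>, should be a copy of
    \<open>X\<close>. The inverse isomorphisms are \<open>q f\<close> and the arrow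
    \<open>r'\<close> through which \<open>r\<close> factors because \<open>r s = 0\<close>.\<close>
  obtain Q q k where u: "dtri Z M Q s q k" using ex_cone s by blast
  note hu = dtri_Hom[OF u] note ou = dtri_Obj[OF u]
  obtain r' where r': "r' \<in> Hom C Q X" "r' \<bullet> q = r" using dtri_extend[OF u r(1) rs] by blast
  have qf: "q \<bullet> f \<in> Hom C X Q" using hu hm comp_closed by blast
  have inv1: "r' \<bullet> (q \<bullet> f) = ident C X" using comp_assoc[OF hm(1) hu(2) r'(1)] r'(2) r(2) by simp
  have sg: "s \<bullet> g \<in> Hom C M M" and fr: "f \<bullet> r \<in> Hom C M M" using s r hm comp_closed by blast+
  have "q \<bullet> (s \<bullet> g) = zero_arr C M Q"
    using comp_assoc[OF hm(2) s(1) hu(2)] dtri_comp_zero(1)[OF u] zero_comp[OF ou(3) hm(2)] by simp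
  then have "q \<bullet> (f \<bullet> r) = q"
    using comp_plus[OF fr sg hu(2)] sum comp_ident[OF hu(2)] plus_zero comp_closed[OF fr hu(2)] by simp
  then have qq: "((q \<bullet> f) \<bullet> r') \<bullet> q = q"
    using comp_assoc[OF hu(2) r'(1) qf] r'(2) comp_assoc[OF r(1) hm(1) hu(2)] by simp
  have e: "(q \<bullet> f) \<bullet> r' \<in> Hom C Q Q" using qf r' comp_closed by blast
  have iQ: "ident C Q \<in> Hom C Q Q" using ident_closed ou by blast
  obtain d where d: "d \<in> Hom C Q Q" "((q \<bullet> f) \<bullet> r') \<oplus> d = ident C Q"
    using ex_diff[OF e iQ] by blast
  have "q \<oplus> (d \<bullet> q) = q" using plus_comp[OF hu(2) e d(1)] d(2) qq ident_comp[OF hu(2)] by simp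
  then have "d \<bullet> q = zero_arr C M Q" using plus_eq_self hu d comp_closed by blast
  then obtain v where v: "v \<in> Hom C (shift C Z) Q" "v \<bullet> k = d"
    using dtri_extend[OF dtri_rotate[OF u] d(1)] by blast
  have ss: "shift_arr C s \<in> Hom C (shift C Z) (shift C M)" using s shift_arr_hom by blast
  have sg': "shift_arr C g \<in> Hom C (shift C M) (shift C Z)" using hm shift_arr_hom by blast
  \<comment> \<open>\<open>k\<close> is killed by the shift of \<open>s\<close>, which is split
    monic with retraction the shift of \<open>g\<close>. So \<open>k\<close>, and with it the error
    \<open>d = v k\<close>, vanishes.\<close>
  have "neg_arr C (shift_arr C s) \<bullet> k = zero_arr C Q (shift C M)"
    using dtri_comp_zero(2)[OF dtri_rotate[OF u]] .
  then have "neg_arr C (shift_arr C s \<bullet> k) = zero_arr C Q (shift C M)"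
    using neg_comp[OF hu(3) ss] by simp
  then have "shift_arr C s \<bullet> k = zero_arr C Q (shift C M)"
    using plus_neg[OF comp_closed[OF hu(3) ss]] plus_zero[OF comp_closed[OF hu(3) ss]] by simp
  then have "(shift_arr C g \<bullet> shift_arr C s) \<bullet> k = zero_arr C Q (shift C Z)"
    using comp_assoc[OF hu(3) ss sg'] comp_zero[OF ou(3) sg'] by simp
  moreover have "shift_arr C g \<bullet> shift_arr C s = ident C (shift C Z)"
    using shift_comp[OF s(1) hm(2)] s(2) shift_ident o by simp
  ultimately have "k = zero_arr C Q (shift C Z)" using ident_comp[OF hu(3)] by simp
  then have "d = zero_arr C Q Q" using v comp_zero[OF ou(3) v(1)] by simp
  then have inv2: "(q \<bullet> f) \<bullet> r' = ident C Q" using d plus_zero[OF e] by simp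
  have "isomorphic C Q X"
    unfolding isomorphic_def iso_arrow_def using r' qf inv1 inv2 by blast
  then have "Q \<in> E"
    using extension_closed_imp_iso_closed[OF E] X ou unfolding iso_closed_def by blast
  then show "M \<in> star D E" using starI u Z by blast
qed

text \<open>An extension of two objects of \<open>D * E\<close> lies in
  \<open>D * E * D * E\<close>. The orthogonality lets the inner \<open>E * D\<close> be exchanged
  for \<open>D * E\<close>, after which \<open>D * D\<close> and \<open>E * E\<close> are
  absorbed.\<close>

lemma extension_closed_star:
  assumes D: "extension_closed C D" and E: "extension_closed C E" and p: "perp C D (shift C ` E)"
  shows "extension_closed C (star D E)"
  unfolding extension_closed_iff
proof (intro conjI allI impI)
  show "star D E \<subseteq> Obj C" unfolding star_def using dtri_Obj by blast
  show "Z \<in> star D E" if "zero_object C Z" for Z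
    using that subset_star[OF D E] extension_closedD(2)[OF D] by blast
  fix X Y Z f g h
  assume "dtri X Y Z f g h" "X \<in> star D E" "Z \<in> star D E"
  then have "Y \<in> star (star D E) (star D E)" by (rule starI)
  also have "\<dots> \<subseteq> star D (star E (star D E))" by (rule star_assoc_right)
  also have "\<dots> \<subseteq> star D (star (star E D) E)" by (intro star_mono star_assoc_left order_refl)
  also have "\<dots> \<subseteq> star D (star (star D E) E)" by (intro star_mono star_swap[OF p E] order_refl)
  also have "\<dots> \<subseteq> star D (star D (star E E))" by (intro star_mono star_assoc_right order_refl)
  also have "\<dots> \<subseteq> star D (star D E)" by (intro star_mono star_subset[OF E] order_refl)
  also have "\<dots> \<subseteq> star (star D D) E" by (rule star_assoc_left)
  also have "\<dots> \<subseteq> star D E" by (intro star_mono star_subset[OF D] order_refl)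
  finally show "Y \<in> star D E" .
qed

subsection \<open>Shifts of classes\<close>

lemma image_shift_Obj: "shift C ` Obj C = Obj C"
  using shift_bij unfolding bij_betw_def by blast

lemma mem_image_shift_iff:
  "\<lbrakk>D \<subseteq> Obj C; X \<in> Obj C\<rbrakk> \<Longrightarrow> shift C X \<in> shift C ` D \<longleftrightarrow> X \<in> D"
  using shift_inj by blast

lemma zero_object_shift_iff:
  assumes "Z \<in> Obj C"
  shows "zero_object C (shift C Z) \<longleftrightarrow> zero_object C Z"
  unfolding zero_object_iff using assms shift_Obj shift_ident shift_zero shift_arr_faithful
    ident_closed zero_closed by metis

lemma retract_of_shift_iff:
  assumes "X \<in> Obj C" "Y \<in> Obj C"
  shows "retract_of C (shift C X) (shift C Y) \<longleftrightarrow> retract_of C X Y"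
proof
  assume "retract_of C (shift C X) (shift C Y)"
  then obtain i' p' where "i' \<in> Hom C (shift C X) (shift C Y)" "p' \<in> Hom C (shift C Y) (shift C X)"
    "p' \<bullet> i' = ident C (shift C X)" unfolding retract_of_def by blast
  moreover from this obtain i p where ip: "i \<in> Hom C X Y" "i' = shift_arr C i" "p \<in> Hom C Y X"
    "p' = shift_arr C p" using shift_arr_full assms by metis
  ultimately have "shift_arr C (p \<bullet> i) = shift_arr C (ident C X)"
    using shift_comp[OF ip(1,3)] shift_ident assms by simp
  then have "p \<bullet> i = ident C X"
    using shift_arr_faithful comp_closed[OF ip(1,3)] ident_closed assms by blast
  then show "retract_of C X Y" unfolding retract_of_def using ip by blast
next
  assume "retract_of C X Y"
  then obtain i p where ip: "i \<in> Hom C X Y" "p \<in> Hom C Y X" "p \<bullet> i = ident C X"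
    unfolding retract_of_def by blast
  then have "shift_arr C p \<bullet> shift_arr C i = ident C (shift C X)"
    using shift_comp shift_ident assms by metis
  then show "retract_of C (shift C X) (shift C Y)"
    unfolding retract_of_def using ip shift_arr_hom by blast
qed

lemma retraction_closed_shift_iff:
  assumes D: "D \<subseteq> Obj C"
  shows "retraction_closed C (shift C ` D) \<longleftrightarrow> retraction_closed C D"
proof
  assume l: "retraction_closed C (shift C ` D)"
  show "retraction_closed C D" unfolding retraction_closed_def
  proof (intro conjI D ballI impI)
    fix Y X assume a: "Y \<in> D" "X \<in> Obj C" "retract_of C X Y"
    then have "retract_of C (shift C X) (shift C Y)" using retract_of_shift_iff D by blast
    then have "shift C X \<in> shift C ` D"
      using l a shift_Obj unfolding retraction_closed_def by blast
    then show "X \<in> D" using mem_image_shift_iff D a by blast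
  qed
next
  assume r: "retraction_closed C D"
  show "retraction_closed C (shift C ` D)" unfolding retraction_closed_def
  proof (intro conjI ballI impI)
    show "shift C ` D \<subseteq> Obj C" using D shift_Obj by blast
    fix Y' X' assume a: "Y' \<in> shift C ` D" "X' \<in> Obj C" "retract_of C X' Y'"
    obtain Y where Y: "Y \<in> D" "Y' = shift C Y" using a by blast
    obtain X where X: "X \<in> Obj C" "X' = shift C X" using shift_surj a by blast
    have "Y \<in> Obj C" using Y D by blast
    then have "retract_of C X Y" using a(3) X(2) Y(2) retract_of_shift_iff[OF X(1)] by simp
    then show "X' \<in> shift C ` D" using r X Y unfolding retraction_closed_def by blast
  qed
qed

lemma extension_closed_shift_iff:
  assumes D: "D \<subseteq> Obj C"
  shows "extension_closed C (shift C ` D) \<longleftrightarrow> extension_closed C D"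
proof
  assume l: "extension_closed C (shift C ` D)"
  show "extension_closed C D" unfolding extension_closed_iff
  proof (intro conjI D allI impI)
    show "Z \<in> D" if "zero_object C Z" for Z
      using that zero_object_shift_iff[OF zero_object_Obj[OF that]] extension_closedD(2)[OF l]
        mem_image_shift_iff[OF D zero_object_Obj[OF that]] by blast
    fix X Y Z f g h assume a: "dtri X Y Z f g h" "X \<in> D" "Z \<in> D"
    obtain f' g' h' where "dtri (shift C X) (shift C Y) (shift C Z) f' g' h'"
      using dtri_shift[OF a(1)] by blast
    then have "shift C Y \<in> shift C ` D" using extension_closedD(3)[OF l] a by blast
    then show "Y \<in> D" using mem_image_shift_iff D dtri_Obj[OF a(1)] by blast
  qed
next
  assume r: "extension_closed C D"
  show "extension_closed C (shift C ` D)" unfolding extension_closed_iff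
  proof (intro conjI allI impI)
    show "shift C ` D \<subseteq> Obj C" using D shift_Obj by blast
    show "Z' \<in> shift C ` D" if z: "zero_object C Z'" for Z'
    proof -
      obtain Z where Z: "Z \<in> Obj C" "Z' = shift C Z" using shift_surj zero_object_Obj z by blast
      then have "zero_object C Z" using z zero_object_shift_iff[OF Z(1)] by simp
      then show ?thesis using Z extension_closedD(2)[OF r] by blast
    qed
    fix X' Y' Z' f g h assume a: "dtri X' Y' Z' f g h" "X' \<in> shift C ` D" "Z' \<in> shift C ` D"
    obtain X where X: "X \<in> D" "X' = shift C X" using a by blast
    obtain Z where Z: "Z \<in> D" "Z' = shift C Z" using a by blast
    obtain Y where Y: "Y \<in> Obj C" "Y' = shift C Y" using shift_surj dtri_Obj[OF a(1)] by blast
    obtain f' g' h' where "dtri X Y Z f' g' h'"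
      using dtri_unshift[of X Y Z f g h] a(1) X Y Z D by blast
    then show "Y' \<in> shift C ` D" using extension_closedD(3)[OF r] X Y Z by blast
  qed
qed

lemma shift_extension_closure:
  assumes D: "D \<subseteq> Obj C"
  shows "shift C ` extension_closure C D = extension_closure C (shift C ` D)"
proof
  have sD: "shift C ` D \<subseteq> Obj C" using D shift_Obj by blast
  note ec = extension_closed_extension_closure[OF D]
  show "extension_closure C (shift C ` D) \<subseteq> shift C ` extension_closure C D"
    by (rule extension_closure_least)
      (use extension_closed_shift_iff[OF extension_closedD(1)[OF ec]] ec subset_extension_closure
        in auto)
  \<comment> \<open>The preimage of the right-hand side under the shift; it is extension-closed
    because its image under the shift is.\<close>
  let ?F = "{X \<in> Obj C. shift C X \<in> extension_closure C (shift C ` D)}"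
  note ec' = extension_closed_extension_closure[OF sD]
  have "shift C ` ?F = extension_closure C (shift C ` D)"
    using extension_closedD(1)[OF ec'] image_shift_Obj by auto
  then have "extension_closed C ?F" using extension_closed_shift_iff[of ?F] ec' by simp
  moreover have "D \<subseteq> ?F" using D subset_extension_closure by blast
  ultimately have "extension_closure C D \<subseteq> ?F" by (rule extension_closure_least)
  then show "shift C ` extension_closure C D \<subseteq> extension_closure C (shift C ` D)" by blast
qed

lemma perp_shift_iff:
  assumes "D \<subseteq> Obj C" "E \<subseteq> Obj C"
  shows "perp C (shift C ` D) (shift C ` E) \<longleftrightarrow> perp C D E"
proof
  assume l: "perp C (shift C ` D) (shift C ` E)"
  show "perp C D E" unfolding perp_def
  proof (intro ballI)
    fix X Y f assume a: "X \<in> D" "Y \<in> E" "f \<in> Hom C X Y"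
    then have "shift_arr C f = zero_arr C (shift C X) (shift C Y)"
      using l shift_arr_hom unfolding perp_def by blast
    then have "shift_arr C f = shift_arr C (zero_arr C X Y)" using shift_zero[OF Hom_Obj[OF a(3)]] by simp
    then show "f = zero_arr C X Y" using shift_arr_faithful[OF a(3) zero_closed[OF Hom_Obj[OF a(3)]]] by simp
  qed
next
  assume r: "perp C D E"
  show "perp C (shift C ` D) (shift C ` E)" unfolding perp_def
  proof (intro ballI)
    fix X' Y' f' assume a: "X' \<in> shift C ` D" "Y' \<in> shift C ` E" "f' \<in> Hom C X' Y'"
    then obtain X Y where XY: "X \<in> D" "X' = shift C X" "Y \<in> E" "Y' = shift C Y" by blast
    then obtain f where f: "f \<in> Hom C X Y" "f' = shift_arr C f"
      using shift_arr_full[of f' X Y] a assms by blast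
    then have "f = zero_arr C X Y" using r XY unfolding perp_def by blast
    then show "f' = zero_arr C X' Y'" using f XY shift_zero[OF Hom_Obj[OF f(1)]] by simp
  qed
qed

section \<open>Integer shifts and induction along them\<close>

lemma shift_int_0: "shift_int C 0 X = X"
  unfolding shift_int_def by simp

lemma shift_int_Obj:
  assumes "X \<in> Obj C"
  shows "shift_int C i X \<in> Obj C"
proof -
  have "(shift C ^^ n) X \<in> Obj C" for n by (induction n) (use assms shift_Obj in auto)
  moreover have "inv_into (Obj C) (shift C) Y \<in> Obj C" if "Y \<in> Obj C" for Y
    using that image_shift_Obj inv_into_into[of Y "shift C" "Obj C"] by simp
  then have "(inv_into (Obj C) (shift C) ^^ n) X \<in> Obj C" for n
    by (induction n) (use assms in auto)
  ultimately show ?thesis unfolding shift_int_def by simp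
qed

lemma shift_shift_int:
  assumes "X \<in> Obj C"
  shows "shift C (shift_int C i X) = shift_int C (i + 1) X"
proof (cases "0 \<le> i")
  case True
  then have "nat (i + 1) = Suc (nat i)" by simp
  then show ?thesis unfolding shift_int_def using True by simp
next
  case False
  let ?g = "inv_into (Obj C) (shift C)"
  obtain m where m: "nat (- i) = Suc m" using False by (cases "nat (- i)") auto
  have "shift_int C (- int m) X \<in> Obj C" using shift_int_Obj assms by blast
  \<comment> \<open>For \<open>m = 0\<close> the index \<open>- int m\<close> is \<open>0\<close>
    and selects the nonnegative branch of \<open>shift_int\<close>; both branches then give
    \<open>X\<close>.\<close>
  then have "(?g ^^ m) X \<in> Obj C" unfolding shift_int_def by (cases "m = 0") auto
  then have "shift C (?g ((?g ^^ m) X)) = (?g ^^ m) X"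
    using image_shift_Obj f_inv_into_f by metis
  moreover have "shift_int C (i + 1) X = (?g ^^ m) X"
    using m False unfolding shift_int_def by (cases "m = 0") (auto simp: nat_eq_iff)
  ultimately show ?thesis using m False unfolding shift_int_def by simp
qed

lemma shift_image_shift_int:
  "D \<subseteq> Obj C \<Longrightarrow> shift C ` shift_int C i ` D = shift_int C (i + 1) ` D"
  unfolding image_image by (rule image_cong) (use shift_shift_int in auto)

lemma shift_image_shifts:
  "D \<subseteq> Obj C \<Longrightarrow> shift C ` shifts C I D = shifts C ((\<lambda>i. i + 1) ` I) D"
  unfolding shifts_def using shift_image_shift_int by (simp add: image_UN)

lemma shifts_Obj: "D \<subseteq> Obj C \<Longrightarrow> shifts C I D \<subseteq> Obj C"
  unfolding shifts_def using shift_int_Obj by blast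

text \<open>Two-sided induction for properties that the shift both preserves and reflects; the
  equivalence is what allows descent to negative \<open>i\<close>.\<close>

lemma shift_int_invariant:
  fixes P :: "int \<Rightarrow> bool"
  assumes "P 0" "\<And>i. P (i + 1) \<longleftrightarrow> P i"
  shows "P i"
proof (induction i rule: int_induct[where k = 0])
  case (step2 i)
  then show ?case using assms(2)[of "i - 1"] by simp
qed (use assms in auto)


subsection \<open>Triangulated subcategories\<close>

text \<open>Both closure properties come from rotation: a biproduct of \<open>X\<close> and
  \<open>Y\<close> is the cone of the zero arrow \<open>Y[-1] -> X\<close>, and the cone of
  \<open>f\<close> is an extension of the shifted domain by the codomain.\<close>

lemma extension_closed_imp_full_triangulated:
  assumes D: "extension_closed C D" and sh: "shift C ` D = D"
  shows "full_triangulated_subcategory C D"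
  unfolding full_triangulated_subcategory_def full_additive_subcategory_def
proof (intro conjI sh ballI impI)
  show "D \<subseteq> Obj C" using extension_closedD(1)[OF D] .
  show "\<exists>Z \<in> D. zero_object C Z" using ex_zero_object extension_closedD(2)[OF D] by blast
next
  fix X Y assume X: "X \<in> D" and Y: "Y \<in> D"
  then obtain Y' where Y': "Y' \<in> D" "Y = shift C Y'" using sh by blast
  have o: "X \<in> Obj C" "Y \<in> Obj C" "Y' \<in> Obj C" using X Y Y' extension_closedD(1)[OF D] by auto
  obtain S g h where "dtri Y' X S (zero_arr C Y' X) g h"
    using ex_cone[OF zero_closed[OF o(3,1)]] by blast
  then have t: "dtri X S Y g h (neg_arr C (shift_arr C (zero_arr C Y' X)))"
    using dtri_rotate Y' by blast
  have z: "zero_arr C Y (shift C X) \<in> Hom C Y (shift C X)"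
    using zero_closed[OF o(2) shift_Obj[OF o(1)]] .
  have n: "neg_arr C (shift_arr C (zero_arr C Y' X)) = zero_arr C Y (shift C X)"
    using shift_zero[OF o(3,1)] Y'(2) neg_unique[OF z z plus_zero[OF z]] by simp
  obtain s p where sp: "s \<in> Hom C Y S" "p \<in> Hom C S X" "h \<bullet> s = ident C Y" "p \<bullet> g = ident C X"
    "(g \<bullet> p) \<oplus> (s \<bullet> h) = ident C S" "p \<bullet> s = zero_arr C Y X"
    using dtri_split[OF t n] .
  have "biproduct C X Y S"
    unfolding biproduct_def
    using sp dtri_Hom[OF t] dtri_comp_zero(1)[OF t] dtri_Obj(2)[OF t] by blast
  moreover have "S \<in> D" using extension_closedD(3)[OF D t X Y] .
  ultimately show "\<exists>S \<in> D. biproduct C X Y S" by blast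
next
  fix f assume f: "f \<in> Arr C" and d: "Dom C f \<in> D \<and> Cod C f \<in> D"
  obtain g h where gh: "(f, g, h) \<in> dist C" using TR1_cone f by blast
  have "shift C (Dom C f) \<in> D" using d sh by blast
  then have "Cod C g \<in> D"
    using extension_closedD(3)[OF D dtri_rotate[OF dist_imp_dtri[OF gh]]] d by blast
  then show "\<exists>g h. (f, g, h) \<in> dist C \<and> Cod C g \<in> D" using gh by blast
qed

text \<open>The middle term \<open>Y\<close> is a cone of an arrow \<open>Z[-1] -> X\<close>. A
  triangulated subcategory contains some cone of it, and cones are unique up to isomorphism.\<close>

lemma full_triangulated_imp_extension_closed:
  assumes T: "full_triangulated_subcategory C T" and iso: "iso_closed C T"
  shows "extension_closed C T"
  unfolding extension_closed_iff
proof (intro conjI allI impI)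
  show To: "T \<subseteq> Obj C" using iso unfolding iso_closed_def by blast
  show "Z \<in> T" if "zero_object C Z" for Z
  proof -
    obtain Z' where "Z' \<in> T" "zero_object C Z'"
      using T unfolding full_triangulated_subcategory_def full_additive_subcategory_def by blast
    then show ?thesis
      using zero_objects_isomorphic[OF that] zero_object_Obj[OF that] iso
      unfolding iso_closed_def by blast
  qed
  fix X Y Z f g h assume t: "dtri X Y Z f g h" and X: "X \<in> T" and Z: "Z \<in> T"
  obtain Z' where Z': "Z' \<in> T" "Z = shift C Z'"
    using T Z unfolding full_triangulated_subcategory_def by blast
  obtain k where k: "dtri Z' X Y k f g"
    using dtri_unrotate[of X Y Z' f g h] t Z' To by blast
  have "k \<in> Arr C" "Dom C k \<in> T" "Cod C k \<in> T"
    using dtri_Hom(1)[OF k] X Z' unfolding Hom_def by auto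
  then obtain u v where u: "(k, u, v) \<in> dist C" "Cod C u \<in> T"
    using T unfolding full_triangulated_subcategory_def by blast
  have "dtri Z' X (Cod C u) k u v"
    using dist_imp_dtri[OF u(1)] dtri_dist[OF k] by simp
  then have "isomorphic C Y (Cod C u)" using cone_isomorphic[OF k] by blast
  then show "Y \<in> T" using iso u dtri_Obj[OF t] unfolding iso_closed_def by blast
qed

lemma shifts_subset_of_shift_invariant:
  assumes "D \<subseteq> T" "T \<subseteq> Obj C" "shift C ` T = T"
  shows "shifts C I D \<subseteq> T"
proof -
  have "shift_int C i X \<in> T" if X: "X \<in> D" for X i
  proof (rule shift_int_invariant[of "\<lambda>i. shift_int C i X \<in> T"])
    have o: "X \<in> Obj C" using X assms by blast
    show "shift_int C 0 X \<in> T" using X assms shift_int_0 by auto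
    show "shift_int C (i + 1) X \<in> T \<longleftrightarrow> shift_int C i X \<in> T" for i
      using mem_image_shift_iff[OF assms(2) shift_int_Obj[OF o]] shift_shift_int[OF o] assms(3)
      by metis
  qed
  then show ?thesis unfolding shifts_def by blast
qed

section \<open>Weight structures\<close>

lemma weight_structureD:
  assumes "weight_structure C vle vge"
  shows "retraction_closed C vle" "retraction_closed C vge" "perp C vle (shift C ` vge)"
    "vle \<subseteq> Obj C" "vge \<subseteq> Obj C" "vle \<subseteq> shift C ` vle" "shift C ` vge \<subseteq> vge"
  using assms unfolding weight_structure_def retraction_closed_def by simp_all

lemma weight_decomposition:
  assumes "weight_structure C vle vge" "M \<in> Obj C"
  obtains X Y f g h where "dtri X M Y f g h" "X \<in> vle" "Y \<in> shift C ` vge"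
proof -
  obtain f g h where "(f, g, h) \<in> dist C" "Dom C f \<in> vle" "Cod C f = M" "Cod C g \<in> shift C ` vge"
    using assms unfolding weight_structure_def by meson
  then show thesis using that dist_imp_dtri by metis
qed

text \<open>If \<open>M\<close> has no arrows to \<open>vge[1]\<close>, then \<open>M -> Y\<close>
  in its weight decomposition is zero, so the identity of \<open>M\<close> lifts to \<open>X\<close>
  and exhibits \<open>M\<close> as a retract of \<open>X\<close>.\<close>

lemma weight_structure_le:
  assumes w: "weight_structure C vle vge"
  shows "vle = {M \<in> Obj C. perp C {M} (shift C ` vge)}"
proof
  show "vle \<subseteq> {M \<in> Obj C. perp C {M} (shift C ` vge)}"
    using weight_structureD(3,4)[OF w] unfolding perp_def by blast
  show "{M \<in> Obj C. perp C {M} (shift C ` vge)} \<subseteq> vle"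
  proof clarify
    fix M assume M: "M \<in> Obj C" "perp C {M} (shift C ` vge)"
    obtain X Y f g h where t: "dtri X M Y f g h" and X: "X \<in> vle" and Y: "Y \<in> shift C ` vge"
      using weight_decomposition[OF w M(1)] .
    note hm = dtri_Hom[OF t]
    have "g = zero_arr C M Y" using M(2) Y hm(2) unfolding perp_def by blast
    then have "g \<bullet> ident C M = zero_arr C M Y" using comp_ident[OF hm(2)] by simp
    then obtain v where "v \<in> Hom C M X" "f \<bullet> v = ident C M"
      using dtri_lift[OF t ident_closed[OF M(1)]] by blast
    then have "retract_of C M X" unfolding retract_of_def using hm(1) by blast
    then show "M \<in> vle" using weight_structureD(1)[OF w] X M unfolding retraction_closed_def by blast
  qed
qed

lemma weight_structure_ge:
  assumes w: "weight_structure C vle vge"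
  shows "shift C ` vge = {M \<in> Obj C. perp C vle {M}}"
proof
  note vo = weight_structureD(5)[OF w]
  have "shift C ` vge \<subseteq> Obj C" using vo shift_Obj by blast
  then show "shift C ` vge \<subseteq> {M \<in> Obj C. perp C vle {M}}"
    using weight_structureD(3)[OF w] unfolding perp_def by blast
  have rc: "retraction_closed C (shift C ` vge)"
    using retraction_closed_shift_iff[OF vo] weight_structureD(2)[OF w] by blast
  show "{M \<in> Obj C. perp C vle {M}} \<subseteq> shift C ` vge"
  proof
    fix M assume "M \<in> {M \<in> Obj C. perp C vle {M}}"
    then have M: "M \<in> Obj C" "perp C vle {M}" by auto
    obtain X Y f g h where t: "dtri X M Y f g h" and X: "X \<in> vle" and Y: "Y \<in> shift C ` vge"
      using weight_decomposition[OF w M(1)] .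
    note hm = dtri_Hom[OF t]
    have "f = zero_arr C X M" using M(2) X hm(1) unfolding perp_def by blast
    then have "ident C M \<bullet> f = zero_arr C X M" using ident_comp[OF hm(1)] by simp
    then obtain v where "v \<in> Hom C Y M" "v \<bullet> g = ident C M"
      using dtri_extend[OF t ident_closed[OF M(1)]] by blast
    then have "retract_of C M Y" unfolding retract_of_def using hm(2) by blast
    then show "M \<in> shift C ` vge" using rc Y M unfolding retraction_closed_def by blast
  qed
qed

lemma weight_structure_extension_closed:
  assumes w: "weight_structure C vle vge"
  shows "extension_closed C vle" "extension_closed C vge"
proof -
  note o = weight_structureD(4,5)[OF w]
  then have so: "shift C ` vge \<subseteq> Obj C" using shift_Obj by blast
  show "extension_closed C vle"
    using extension_closed_left_perp[OF so] weight_structure_le[OF w] by simp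
  show "extension_closed C vge"
    using extension_closed_right_perp[OF o(1)] weight_structure_ge[OF w]
      extension_closed_shift_iff[OF o(2)] by simp
qed

lemma weight_structure_shifts_le:
  assumes w: "weight_structure C vle vge" and D: "D \<subseteq> vle"
  shows "shifts C {..0} D \<subseteq> vle"
proof -
  note o = weight_structureD(4)[OF w] note s = weight_structureD(6)[OF w]
  have *: "shift_int C (- int n) X \<in> vle" if X: "X \<in> D" for X n
  proof (induction n)
    case 0
    then show ?case using X D shift_int_0 by auto
  next
    case (Suc n)
    have Xo: "X \<in> Obj C" using X D o by blast
    have "shift C (shift_int C (- int (Suc n)) X) \<in> shift C ` vle"
      using Suc s shift_shift_int[OF Xo, of "- int (Suc n)"] by auto
    then show ?case using mem_image_shift_iff[OF o shift_int_Obj[OF Xo]] by blast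
  qed
  have "shift_int C i X \<in> vle" if "X \<in> D" "i \<le> 0" for X i
    using *[OF that(1), of "nat (- i)"] that(2) by simp
  then show ?thesis unfolding shifts_def by blast
qed

lemma weight_structure_shifts_ge:
  assumes w: "weight_structure C vle vge" and D: "D \<subseteq> vge"
  shows "shifts C {0..} D \<subseteq> vge"
proof -
  note o = weight_structureD(5)[OF w] note s = weight_structureD(7)[OF w]
  have *: "shift_int C (int n) X \<in> vge" if X: "X \<in> D" for X n
  proof (induction n)
    case 0
    then show ?case using X D shift_int_0 by auto
  next
    case (Suc n)
    have Xo: "X \<in> Obj C" using X D o by blast
    have "shift_int C (int (Suc n)) X = shift C (shift_int C (int n) X)"
      using shift_shift_int[OF Xo, of "int n"] by (simp add: add.commute)
    then show ?case using Suc s by auto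
  qed
  have "shift_int C i X \<in> vge" if "X \<in> D" "0 \<le> i" for X i
    using *[OF that(1), of "nat i"] that(2) by simp
  then show ?thesis unfolding shifts_def by blast
qed

text \<open>Each half is the orthogonal of the other, so enlarging one half shrinks the other; two
  structures nested in both halves must agree.\<close>

lemma weight_structure_antimono:
  assumes v: "weight_structure C vle vge" and w: "weight_structure C wle wge"
    and sub: "wle \<subseteq> vle" "wge \<subseteq> vge"
  shows "vle = wle" "vge = wge"
proof -
  have "vle \<subseteq> wle"
  proof
    fix M assume M: "M \<in> vle"
    then have "perp C {M} (shift C ` wge)"
      using weight_structureD(3)[OF v] sub(2) unfolding perp_def by blast
    then show "M \<in> wle" using weight_structure_le[OF w] weight_structureD(4)[OF v] M by auto
  qed
  then show "vle = wle" using sub by blast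
  note o = weight_structureD(5)[OF v] weight_structureD(5)[OF w]
  have "shift C ` vge \<subseteq> shift C ` wge"
    unfolding weight_structure_ge[OF v] weight_structure_ge[OF w]
    using sub(1) unfolding perp_def by blast
  then have "vge \<subseteq> wge" using mem_image_shift_iff[OF o(2)] o(1) by blast
  then show "vge = wge" using sub by blast
qed

section \<open>Negative subcategories\<close>

lemma retract_of_shift_int:
  assumes "X \<in> Obj C" "Y \<in> Obj C" "retract_of C X Y"
  shows "retract_of C (shift_int C i X) (shift_int C i Y)"
proof (rule shift_int_invariant[of "\<lambda>i. retract_of C (shift_int C i X) (shift_int C i Y)"])
  show "retract_of C (shift_int C 0 X) (shift_int C 0 Y)" using assms shift_int_0 by simp
  show "retract_of C (shift_int C (i + 1) X) (shift_int C (i + 1) Y) \<longleftrightarrow>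
      retract_of C (shift_int C i X) (shift_int C i Y)" for i
    using retract_of_shift_iff[OF shift_int_Obj[OF assms(1)] shift_int_Obj[OF assms(2)]]
      shift_shift_int[OF assms(1)] shift_shift_int[OF assms(2)] by metis
qed

lemma negative_Kar:
  assumes o: "B \<subseteq> Obj C" and neg: "negative C B"
  shows "negative C (Kar C B)"
proof -
  have "perp C {X} {shift_int C i Y}" if X: "X \<in> Kar C B" and Y: "Y \<in> Kar C B" and i: "0 < i" for X Y i
  proof -
    obtain X' where X': "X' \<in> B" "retract_of C X X'" "X \<in> Obj C" using X Kar_eq[OF o] by blast
    obtain Y' where Y': "Y' \<in> B" "retract_of C Y Y'" "Y \<in> Obj C" using Y Kar_eq[OF o] by blast
    have oX: "X' \<in> Obj C" and oY: "Y' \<in> Obj C" using X' Y' o by auto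
    have "shift_int C i Y' \<in> shifts C {0<..} B" unfolding shifts_def using Y' i by blast
    then have "perp C {X'} {shift_int C i Y'}" using neg X' unfolding negative_def perp_def by blast
    then have "perp C {X} {shift_int C i Y'}"
      using perp_retract_left[OF _ X'(2,3)] shift_int_Obj[OF oY] by blast
    then show ?thesis
      using perp_retract_right[OF _ retract_of_shift_int[OF Y'(3) oY Y'(2)] shift_int_Obj[OF Y'(3)]] X'
      by blast
  qed
  then show ?thesis unfolding negative_def perp_def shifts_def by blast
qed

text \<open>Negativity kills the connecting arrow \<open>Z -> X[1]\<close>, so \<open>Y\<close> is a
  direct sum of \<open>X\<close> and \<open>Z\<close>. If these are retracts of \<open>X'\<close>
  and \<open>Z'\<close> in \<open>B\<close>, then \<open>Y\<close> is a retract of a biproduct of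
  \<open>X'\<close> and \<open>Z'\<close> that lies in \<open>B\<close>.\<close>

lemma extension_closed_Kar:
  assumes B: "full_additive_subcategory C B" and neg: "negative C B"
  shows "extension_closed C (Kar C B)"
proof -
  have o: "B \<subseteq> Obj C" using B unfolding full_additive_subcategory_def by blast
  note negK = negative_Kar[OF o neg]
  show ?thesis unfolding extension_closed_iff
  proof (intro conjI allI impI)
    show "Kar C B \<subseteq> Obj C" using Kar_eq[OF o] by blast
    show "Z \<in> Kar C B" if Z: "zero_object C Z" for Z
    proof -
      obtain Z' where "Z' \<in> B" "zero_object C Z'"
        using B unfolding full_additive_subcategory_def by blast
      then show ?thesis
        using zero_objects_isomorphic[OF Z] isomorphic_retract_of zero_object_Obj[OF Z] Kar_eq[OF o]
        by blast
    qed
    fix X Y Z f g h assume t: "dtri X Y Z f g h" and X: "X \<in> Kar C B" and Z: "Z \<in> Kar C B"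
    note hm = dtri_Hom[OF t] note ot = dtri_Obj[OF t]
    have "shift C X = shift_int C 1 X" using shift_shift_int[OF ot(1), of 0] shift_int_0 by simp
    then have "shift C X \<in> shifts C {0<..} (Kar C B)" unfolding shifts_def using X by auto
    then have "h = zero_arr C Z (shift C X)" using negK Z hm unfolding negative_def perp_def by blast
    then obtain s p where sp: "s \<in> Hom C Z Y" "p \<in> Hom C Y X" "(f \<bullet> p) \<oplus> (s \<bullet> g) = ident C Y"
      using dtri_split[OF t] by metis
    obtain X' a a' where X': "X' \<in> B" "a \<in> Hom C X X'" "a' \<in> Hom C X' X" "a' \<bullet> a = ident C X"
      using X Kar_eq[OF o] unfolding retract_of_def by blast
    obtain Z' b b' where Z': "Z' \<in> B" "b \<in> Hom C Z Z'" "b' \<in> Hom C Z' Z" "b' \<bullet> b = ident C Z"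
      using Z Kar_eq[OF o] unfolding retract_of_def by blast
    obtain S i j q r where S: "S \<in> B" and i: "i \<in> Hom C X' S" and j: "j \<in> Hom C Z' S"
      and q: "q \<in> Hom C S X'" and r: "r \<in> Hom C S Z'"
      and qi: "q \<bullet> i = ident C X'" and rj: "r \<bullet> j = ident C Z'"
      and qj: "q \<bullet> j = zero_arr C Z' X'" and ri: "r \<bullet> i = zero_arr C X' Z'"
      using B X' Z' unfolding full_additive_subcategory_def biproduct_def by metis
    define u where "u = a \<bullet> p" define v where "v = b \<bullet> g"
    define u' where "u' = f \<bullet> a'" define v' where "v' = s \<bullet> b'"
    have u: "u \<in> Hom C Y X'" and v: "v \<in> Hom C Y Z'" and u': "u' \<in> Hom C X' Y" and v': "v' \<in> Hom C Z' Y"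
      unfolding u_def v_def u'_def v'_def
      using comp_closed[OF sp(2) X'(2)] comp_closed[OF hm(2) Z'(2)] comp_closed[OF X'(3) hm(1)]
        comp_closed[OF Z'(3) sp(1)] by auto
    have u'u: "u' \<bullet> u = f \<bullet> p"
      unfolding u_def u'_def
      using comp_assoc[OF comp_closed[OF sp(2) X'(2)] X'(3) hm(1)] comp_assoc[OF sp(2) X'(2,3)]
        X'(4) ident_comp[OF sp(2)] by simp
    have v'v: "v' \<bullet> v = s \<bullet> g"
      unfolding v_def v'_def
      using comp_assoc[OF comp_closed[OF hm(2) Z'(2)] Z'(3) sp(1)] comp_assoc[OF hm(2) Z'(2,3)]
        Z'(4) ident_comp[OF hm(2)] by simp
    \<comment> \<open>\<open>k\<close> and \<open>l\<close> are the sums of the two inclusions and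
      of the two retractions, routed through the components of \<open>S\<close>; thus
      \<open>l k = f p + s g = 1\<close>.\<close>
    define k where "k = (i \<bullet> u) \<oplus> (j \<bullet> v)"
    define l where "l = (u' \<bullet> q) \<oplus> (v' \<bullet> r)"
    note iu = comp_closed[OF u i] note jv = comp_closed[OF v j]
    note u'q = comp_closed[OF q u'] note v'r = comp_closed[OF r v']
    have k: "k \<in> Hom C Y S" unfolding k_def using plus_closed[OF iu jv] .
    have l: "l \<in> Hom C S Y" unfolding l_def using plus_closed[OF u'q v'r] .
    have o': "Y \<in> Obj C" "X' \<in> Obj C" "Z' \<in> Obj C" using ot X' Z' o by auto
    have "q \<bullet> k = (q \<bullet> (i \<bullet> u)) \<oplus> (q \<bullet> (j \<bullet> v))" unfolding k_def using comp_plus[OF iu jv q] .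
    also have "q \<bullet> (i \<bullet> u) = u" using comp_assoc[OF u i q] qi ident_comp[OF u] by simp
    also have "q \<bullet> (j \<bullet> v) = zero_arr C Y X'"
      using comp_assoc[OF v j q] qj zero_comp[OF o'(2) v] by simp
    finally have qk: "q \<bullet> k = u" using plus_zero[OF u] by simp
    have "r \<bullet> k = (r \<bullet> (i \<bullet> u)) \<oplus> (r \<bullet> (j \<bullet> v))" unfolding k_def using comp_plus[OF iu jv r] .
    also have "r \<bullet> (i \<bullet> u) = zero_arr C Y Z'"
      using comp_assoc[OF u i r] ri zero_comp[OF o'(3) u] by simp
    also have "r \<bullet> (j \<bullet> v) = v" using comp_assoc[OF v j r] rj ident_comp[OF v] by simp
    finally have rk: "r \<bullet> k = v"
      using plus_zero[OF v] plus_commute[OF v zero_closed[OF o'(1,3)]] by simp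
    have "l \<bullet> k = ((u' \<bullet> q) \<bullet> k) \<oplus> ((v' \<bullet> r) \<bullet> k)" unfolding l_def using plus_comp[OF k u'q v'r] .
    also have "\<dots> = ident C Y"
      using comp_assoc[OF k q u'] comp_assoc[OF k r v'] qk rk u'u v'v sp(3) by simp
    finally have "retract_of C Y S" unfolding retract_of_def using k l by blast
    then show "Y \<in> Kar C B" using Kar_eq[OF o] S o'(1) by blast
  qed
qed

end

section \<open>Objects built from prescribed shifts of a negative class\<close>

locale negative_heart = triangulated_category C
  for C :: "('o, 'm, 'z) triangulated_data_scheme" (structure) +
  fixes K :: "'o set"
  assumes extension_closed_K: "extension_closed C K"
    and retraction_closed_K: "retraction_closed C K"
    and negative_K: "negative C K"
begin

text \<open>The class \<open>E(I)\<close> of the overview; \<open>K\<close> will be instantiated by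
  \<open>Kar C B\<close>.\<close>

definition weights :: "int set \<Rightarrow> 'o set" where
  "weights I = extension_closure C (shifts C I K)"

lemma K_Obj: "K \<subseteq> Obj C"
  using extension_closedD(1)[OF extension_closed_K] .

lemma extension_closed_weights: "extension_closed C (weights I)"
  unfolding weights_def using extension_closed_extension_closure[OF shifts_Obj[OF K_Obj]] .

lemma weights_Obj: "weights I \<subseteq> Obj C"
  using extension_closedD(1)[OF extension_closed_weights] .

lemma weights_mono: "I \<subseteq> J \<Longrightarrow> weights I \<subseteq> weights J"
  unfolding weights_def by (rule extension_closure_mono) (auto simp: shifts_def)

lemma shift_weights: "shift C ` weights I = weights ((\<lambda>i. i + 1) ` I)"
  unfolding weights_def
  using shift_extension_closure[OF shifts_Obj[OF K_Obj]] shift_image_shifts[OF K_Obj] by simp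

text \<open>With the gap \<open>k\<close> fixed the claim is invariant under the shift, and for
  \<open>i = 0\<close> it is negativity.\<close>

lemma perp_shift_int:
  assumes "i < j"
  shows "perp C (shift_int C i ` K) (shift_int C j ` K)"
proof -
  define k where "k = j - i"
  have im: "shift_int C i ` K \<subseteq> Obj C" for i using shift_int_Obj K_Obj by blast
  have "perp C (shift_int C i ` K) (shift_int C (i + k) ` K)"
  proof (rule shift_int_invariant[of "\<lambda>i. perp C (shift_int C i ` K) (shift_int C (i + k) ` K)"])
    have "0 < k" using assms k_def by simp
    then have "shift_int C k ` K \<subseteq> shifts C {0<..} K" unfolding shifts_def by blast
    then show "perp C (shift_int C 0 ` K) (shift_int C (0 + k) ` K)"
      using negative_K unfolding negative_def perp_def by (auto simp: shift_int_0)
    show "perp C (shift_int C (i + 1) ` K) (shift_int C (i + 1 + k) ` K) \<longleftrightarrow>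
      perp C (shift_int C i ` K) (shift_int C (i + k) ` K)" for i
      using perp_shift_iff[OF im im, of i "i + k"] shift_image_shift_int[OF K_Obj]
      by (simp add: algebra_simps)
  qed
  then show ?thesis unfolding k_def by simp
qed

lemma perp_weights:
  assumes "\<forall>i \<in> I. \<forall>j \<in> J. i < j"
  shows "perp C (weights I) (weights J)"
  unfolding weights_def
proof (rule perp_extension_closure)
  show "perp C (shifts C I K) (shifts C J K)"
    using perp_shift_int assms unfolding shifts_def perp_def by blast
qed (use shifts_Obj K_Obj in auto)

text \<open>The product contains all generators and is extension-closed by
  \<open>extension_closed_star\<close>: raising \<open>J\<close> by one keeps it above
  \<open>I\<close>, which gives the required orthogonality.\<close>

lemma weights_Un:
  assumes "\<forall>i \<in> I. \<forall>j \<in> J. i < j"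
  shows "weights (I \<union> J) = star (weights I) (weights J)"
proof
  have "\<forall>i \<in> I. \<forall>j \<in> (\<lambda>i. i + 1) ` J. i < j" using assms by force
  then have p: "perp C (weights I) (shift C ` weights J)" unfolding shift_weights by (rule perp_weights)
  have g: "shifts C I K \<subseteq> weights I" for I unfolding weights_def by (rule subset_extension_closure)
  have "shifts C (I \<union> J) K = shifts C I K \<union> shifts C J K" unfolding shifts_def by blast
  then have "shifts C (I \<union> J) K \<subseteq> star (weights I) (weights J)"
    using subset_star[OF extension_closed_weights extension_closed_weights] g by blast
  then show "weights (I \<union> J) \<subseteq> star (weights I) (weights J)"
    unfolding weights_def[of "I \<union> J"]
    using extension_closure_least extension_closed_star[OF extension_closed_weights extension_closed_weights p]
    by blast
  have "star (weights I) (weights J) \<subseteq> star (weights (I \<union> J)) (weights (I \<union> J))"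
    by (intro star_mono weights_mono) auto
  then show "star (weights I) (weights J) \<subseteq> weights (I \<union> J)"
    using star_subset[OF extension_closed_weights] by blast
qed

lemma weights_decompose:
  assumes "M \<in> weights L" "L = I \<union> J" "\<forall>i \<in> I. \<forall>j \<in> J. i < j"
  obtains X Y f g h where "dtri X M Y f g h" "X \<in> weights I" "Y \<in> weights J"
  using assms(1) unfolding assms(2) weights_Un[OF assms(3)] by (rule starE)

lemma closed_shift_int_image:
  shows "extension_closed C (shift_int C i ` K)" "retraction_closed C (shift_int C i ` K)"
proof -
  have im: "shift_int C i ` K \<subseteq> Obj C" for i using shift_int_Obj K_Obj by blast
  have 0: "shift_int C 0 ` K = K" using shift_int_0 by simp
  show "extension_closed C (shift_int C i ` K)"
    by (rule shift_int_invariant[of "\<lambda>i. extension_closed C (shift_int C i ` K)"])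
      (use extension_closed_K 0 extension_closed_shift_iff[OF im] shift_image_shift_int[OF K_Obj] in auto)
  show "retraction_closed C (shift_int C i ` K)"
    by (rule shift_int_invariant[of "\<lambda>i. retraction_closed C (shift_int C i ` K)"])
      (use retraction_closed_K 0 retraction_closed_shift_iff[OF im] shift_image_shift_int[OF K_Obj] in auto)
qed

text \<open>\<open>K[i]\<close> is already extension-closed. This makes a single weight explicit and
  starts the induction on intervals.\<close>

lemma weights_singleton: "weights {i} = shift_int C i ` K"
  unfolding weights_def shifts_def using extension_closure_eq[OF closed_shift_int_image(1)] by simp

text \<open>The cone \<open>Q\<close> of \<open>1 - i p\<close> is a model of \<open>M \<oplus> M[1]\<close>.\<close>

lemma retraction_closed_weights_interval: "retraction_closed C (weights {a..a + int n})"
proof (induction n arbitrary: a)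
  case 0
  then show ?case using weights_singleton closed_shift_int_image(2) by simp
next
  case (Suc n)
  define b where "b = a + int (Suc n)"
  have ab: "a < b" unfolding b_def by simp
  \<comment> \<open>The lower end is stripped off, so the induction hypothesis is needed at
    \<open>a + 1\<close>; hence the generalization over \<open>a\<close>.\<close>
  have IH: "retraction_closed C (weights {a + 1..b})"
    using Suc[of "a + 1"] unfolding b_def by (simp add: algebra_simps)
  have "M \<in> weights {a..b}"
    if N: "N \<in> weights {a..b}" and M: "M \<in> Obj C" and r: "retract_of C M N" for M N
  proof -
    obtain i p where i: "i \<in> Hom C M N" and p: "p \<in> Hom C N M" and pi: "p \<bullet> i = ident C M"
      using r unfolding retract_of_def by blast
    have No: "N \<in> Obj C" using N weights_Obj by blast
    have idN: "ident C N \<in> Hom C N N" using ident_closed[OF No] .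
    define e where "e = i \<bullet> p"
    have e: "e \<in> Hom C N N" unfolding e_def using comp_closed[OF p i] .
    \<comment> \<open>\<open>f\<close> is \<open>1 - i p\<close>. Since \<open>p f = 0\<close>,
      \<open>p\<close> factors through the cone as \<open>p'\<close>, and \<open>i' = g i\<close> is
      a section of \<open>p'\<close>.\<close>
    obtain f where f: "f \<in> Hom C N N" and ef: "e \<oplus> f = ident C N" using ex_diff[OF e idN] by blast
    obtain Q g h where t: "dtri N N Q f g h" using ex_cone[OF f] by blast
    note g = dtri_Hom(2)[OF t] note h = dtri_Hom(3)[OF t] note Qo = dtri_Obj(3)[OF t]
    have pe: "p \<bullet> e = p" unfolding e_def using comp_assoc[OF p i p] pi ident_comp[OF p] by simp
    have "p \<oplus> (p \<bullet> f) = p" using comp_plus[OF e f p] ef pe comp_ident[OF p] by simp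
    then have "p \<bullet> f = zero_arr C N M" using plus_eq_self[OF p comp_closed[OF f p]] by simp
    then obtain p' where p': "p' \<in> Hom C Q M" "p' \<bullet> g = p" using dtri_extend[OF t p] by blast
    have ge: "g \<bullet> e = g"
      using comp_plus[OF e f g] ef comp_ident[OF g] dtri_comp_zero(1)[OF t]
        plus_zero[OF comp_closed[OF e g]] by simp
    define i' where "i' = g \<bullet> i"
    have i': "i' \<in> Hom C M Q" unfolding i'_def using comp_closed[OF i g] .
    have p'i': "p' \<bullet> i' = ident C M" unfolding i'_def using comp_assoc[OF i g p'(1)] p'(2) pi by simp
    define e' where "e' = i' \<bullet> p'"
    have e': "e' \<in> Hom C Q Q" unfolding e'_def using comp_closed[OF p'(1) i'] .
    \<comment> \<open>\<open>d = 1 - i' p'\<close> projects onto the \<open>M[1]\<close> part of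
      \<open>Q\<close>. It kills \<open>g\<close>, hence factors through \<open>h\<close> into
      \<open>N[1]\<close>.\<close>
    obtain d where d: "d \<in> Hom C Q Q" and ed: "e' \<oplus> d = ident C Q"
      using ex_diff[OF e' ident_closed[OF Qo]] by blast
    have "e' \<bullet> g = g"
      unfolding e'_def using comp_assoc[OF g p'(1) i'] p'(2) comp_assoc[OF p i g] ge
      unfolding i'_def e_def by simp
    then have "g \<oplus> (d \<bullet> g) = g" using plus_comp[OF g e' d] ed ident_comp[OF g] by simp
    then have "d \<bullet> g = zero_arr C N Q" using plus_eq_self[OF g comp_closed[OF g d]] by simp
    then obtain v where v: "v \<in> Hom C (shift C N) Q" "v \<bullet> h = d"
      using dtri_extend[OF dtri_rotate[OF t] d] by blast
    have "(\<lambda>i. i + 1) ` {a..b} = {a + 1..b + 1}" by simp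
    then have sN: "shift C N \<in> weights {a + 1..b + 1}" using N shift_weights[of "{a..b}"] by auto
    have "weights {a..b} \<subseteq> weights {a..b + 1}" "weights {a + 1..b + 1} \<subseteq> weights {a..b + 1}"
      by (intro weights_mono; auto)+
    then have Q: "Q \<in> weights {a..b + 1}"
      using extension_closedD(3)[OF extension_closed_weights dtri_rotate[OF t]] N sN by blast
    \<comment> \<open>Split off the lowest weight of \<open>Q\<close>. Since \<open>N[1]\<close> has
      weights at least \<open>a + 1\<close>, it receives no arrows from \<open>X\<close>; so
      \<open>d x = 0\<close>, that is, \<open>x = i' m\<close> comes from \<open>M\<close>.\<close>
    have "{a..b + 1} = {a} \<union> {a + 1..b + 1}" "\<forall>i \<in> {a}. \<forall>j \<in> {a + 1..b + 1}. i < j"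
      using ab by auto
    then obtain X Y x y z where s: "dtri X Q Y x y z" and X: "X \<in> weights {a}"
      and Y: "Y \<in> weights {a + 1..b + 1}"
      by (rule weights_decompose[OF Q])
    note x = dtri_Hom(1)[OF s] note Xo = dtri_Obj(1)[OF s]
    have "perp C (weights {a}) (weights {a + 1..b + 1})" by (rule perp_weights) auto
    then have "h \<bullet> x = zero_arr C X (shift C N)"
      using X sN comp_closed[OF x h] unfolding perp_def by blast
    then have dx: "d \<bullet> x = zero_arr C X Q" using comp_assoc[OF x h v(1)] v(2) comp_zero[OF Xo v(1)] by simp
    define m where "m = p' \<bullet> x"
    have m: "m \<in> Hom C X M" unfolding m_def using comp_closed[OF x p'(1)] .
    have "e' \<bullet> x = x"
      using plus_comp[OF x e' d] ed ident_comp[OF x] dx plus_zero[OF comp_closed[OF x e']] by simp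
    then have i'm: "i' \<bullet> m = x" unfolding m_def e'_def using comp_assoc[OF x p'(1) i'] by simp
    obtain Y' y' z' where s': "dtri X M Y' m y' z'" using ex_cone[OF m] by blast
    note Y'o = dtri_Obj(3)[OF s']
    have "retract_of C Y' Y" using cone_retract[OF s' s i' i'm p'(1) p'i'] .
    then obtain j q where j: "j \<in> Hom C Y' Y" and q: "q \<in> Hom C Y Y'" and qj: "q \<bullet> j = ident C Y'"
      unfolding retract_of_def by blast
    \<comment> \<open>Now remove the surplus weight \<open>b + 1\<close>. Both \<open>M\<close>, as
      a retract of \<open>N\<close>, and \<open>X[1]\<close>, of weight \<open>a + 1 <= b\<close>,
      are orthogonal to it, hence so is \<open>Y'\<close>, and its inclusion into \<open>Y\<close>
      lifts to \<open>Z\<close>.\<close>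
    have "{a + 1..b + 1} = {a + 1..b} \<union> {b + 1}" "\<forall>i \<in> {a + 1..b}. \<forall>j \<in> {b + 1}. i < j"
      using ab by auto
    then obtain Z W u w k where c: "dtri Z Y W u w k" and Z: "Z \<in> weights {a + 1..b}"
      and W: "W \<in> weights {b + 1}"
      by (rule weights_decompose[OF Y])
    have pN: "perp C (weights {a..b}) (weights {b + 1})" by (rule perp_weights) auto
    have pX: "perp C (weights {a + 1}) (weights {b + 1})" by (rule perp_weights) (use ab in auto)
    have "perp C {N} (weights {b + 1})" using pN N unfolding perp_def by blast
    then have "perp C {M} (weights {b + 1})" using perp_retract_left[OF _ r M weights_Obj] by blast
    moreover have "shift C X \<in> weights {a + 1}" using X shift_weights[of "{a}"] by auto
    then have "perp C {shift C X} (weights {b + 1})" using pX unfolding perp_def by blast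
    ultimately have "perp C {Y'} (weights {b + 1})"
      using perp_extension_left[OF dtri_rotate[OF s']] weights_Obj by blast
    then have "w \<bullet> j = zero_arr C Y' W"
      using W comp_closed[OF j dtri_Hom(2)[OF c]] unfolding perp_def by blast
    then obtain j' where j': "j' \<in> Hom C Y' Z" "u \<bullet> j' = j" using dtri_lift[OF c j] by blast
    note u = dtri_Hom(1)[OF c]
    have "(q \<bullet> u) \<bullet> j' = ident C Y'" using comp_assoc[OF j'(1) u q] j'(2) qj by simp
    then have "retract_of C Y' Z" unfolding retract_of_def using j'(1) comp_closed[OF u q] by blast
    then have "Y' \<in> weights {a + 1..b}" using IH Z Y'o unfolding retraction_closed_def by blast
    \<comment> \<open>\<open>M\<close> is an extension of \<open>Y'\<close> by \<open>X\<close>, and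
      both now have weights in the original interval.\<close>
    moreover have "weights {a} \<subseteq> weights {a..b}" "weights {a + 1..b} \<subseteq> weights {a..b}"
      by (intro weights_mono; use ab in auto)+
    ultimately show ?thesis
      using extension_closedD(3)[OF extension_closed_weights s'] X by blast
  qed
  then have "retraction_closed C (weights {a..b})"
    unfolding retraction_closed_def using weights_Obj by blast
  then show ?case unfolding b_def .
qed

text \<open>The truncated classes form a chain, so the outer terms of a triangle lie in a common
  stage and the union is extension-closed; \<open>K[i]\<close> appears at stage
  \<open>|i|\<close>.\<close>

lemma weights_bounded:
  assumes "M \<in> weights I"
  obtains n where "M \<in> weights (I \<inter> {- int n..int n})"
proof -
  let ?U = "\<Union>n. weights (I \<inter> {- int n..int n})"
  have mono: "weights (I \<inter> {- int m..int m}) \<subseteq> weights (I \<inter> {- int n..int n})" if "m \<le> n" for m n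
    by (rule weights_mono) (use that in auto)
  have "extension_closed C ?U"
    unfolding extension_closed_iff
  proof (intro conjI allI impI)
    show "?U \<subseteq> Obj C" using weights_Obj by blast
    show "Z \<in> ?U" if "zero_object C Z" for Z
      using extension_closedD(2)[OF extension_closed_weights that] by blast
    fix X Y Z f g h assume t: "dtri X Y Z f g h" and X: "X \<in> ?U" and Z: "Z \<in> ?U"
    obtain m n where "X \<in> weights (I \<inter> {- int m..int m})" "Z \<in> weights (I \<inter> {- int n..int n})"
      using X Z by blast
    then have "X \<in> weights (I \<inter> {- int (max m n)..int (max m n)})"
      "Z \<in> weights (I \<inter> {- int (max m n)..int (max m n)})"
      using mono[of m "max m n"] mono[of n "max m n"] by auto
    then show "Y \<in> ?U" using extension_closedD(3)[OF extension_closed_weights t] by blast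
  qed
  moreover have "shifts C I K \<subseteq> ?U"
  proof -
    have "shift_int C i ` K \<subseteq> ?U" if "i \<in> I" for i
    proof -
      have "shift_int C i ` K \<subseteq> weights (I \<inter> {- int (nat \<bar>i\<bar>)..int (nat \<bar>i\<bar>)})"
        unfolding weights_singleton[symmetric] by (rule weights_mono) (use that in auto)
      then show ?thesis by blast
    qed
    then show ?thesis unfolding shifts_def by blast
  qed
  ultimately have "weights I \<subseteq> ?U" unfolding weights_def[of I] by (rule extension_closure_least)
  then show thesis using assms that by blast
qed

lemma retraction_closed_weights:
  assumes "\<And>n. retraction_closed C (weights (I \<inter> {- int n..int n}))"
  shows "retraction_closed C (weights I)"
  unfolding retraction_closed_def
proof (intro conjI ballI impI weights_Obj)
  fix Y X assume a: "Y \<in> weights I" "X \<in> Obj C" "retract_of C X Y"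
  obtain n where "Y \<in> weights (I \<inter> {- int n..int n})" using weights_bounded a(1) .
  then have "X \<in> weights (I \<inter> {- int n..int n})"
    using assms[of n] a unfolding retraction_closed_def by blast
  then show "X \<in> weights I" using weights_mono[of "I \<inter> {- int n..int n}" I] by blast
qed

lemma retraction_closed_weights_le: "retraction_closed C (weights {..0})"
proof (rule retraction_closed_weights)
  fix n
  have "{..0} \<inter> {- int n..int n} = {- int n..- int n + int n}" by auto
  then show "retraction_closed C (weights ({..0} \<inter> {- int n..int n}))"
    using retraction_closed_weights_interval by metis
qed

lemma retraction_closed_weights_ge: "retraction_closed C (weights {0..})"
proof (rule retraction_closed_weights)
  fix n
  have "{0..} \<inter> {- int n..int n} = {0..0 + int n}" by auto
  then show "retraction_closed C (weights ({0..} \<inter> {- int n..int n}))"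
    using retraction_closed_weights_interval by metis
qed

lemma retraction_closed_weights_UNIV: "retraction_closed C (weights UNIV)"
proof (rule retraction_closed_weights)
  fix n
  have "UNIV \<inter> {- int n..int n} = {- int n..- int n + int (2 * n)}" by auto
  then show "retraction_closed C (weights (UNIV \<inter> {- int n..int n}))"
    using retraction_closed_weights_interval by metis
qed

lemma K_subset_weights: "0 \<in> I \<Longrightarrow> K \<subseteq> weights I"
  using weights_mono[of "{0}" I] unfolding weights_singleton by (auto simp: shift_int_0)

lemma heart_weights: "heart (weights {..0}) (weights {0..}) = K"
proof
  show "K \<subseteq> heart (weights {..0}) (weights {0..})"
    unfolding heart_def using K_subset_weights by auto
  show "heart (weights {..0}) (weights {0..}) \<subseteq> K"
  proof
    fix M assume "M \<in> heart (weights {..0}) (weights {0..})"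
    then have le: "M \<in> weights {..0}" and ge: "M \<in> weights {0..}" unfolding heart_def by auto
    have Mo: "M \<in> Obj C" using le weights_Obj by blast
    \<comment> \<open>Separate the negative weights from weight \<open>0\<close>. The negative part
      has no arrows to \<open>M\<close>, which also lies in \<open>weights {0..}\<close>, so
      \<open>M\<close> is a retract of the part \<open>Y\<close> in \<open>K\<close>.\<close>
    have "{..0} = {..-1} \<union> {0::int}" "\<forall>i \<in> {..-1}. \<forall>j \<in> {0::int}. i < j" by auto
    then obtain X Y f g h where t: "dtri X M Y f g h" and X: "X \<in> weights {..-1}" and Y: "Y \<in> weights {0}"
      by (rule weights_decompose[OF le])
    note hm = dtri_Hom[OF t]
    have "perp C (weights {..-1}) (weights {0..})" by (rule perp_weights) auto
    then have "f = zero_arr C X M" using X ge hm(1) unfolding perp_def by blast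
    then have "ident C M \<bullet> f = zero_arr C X M" using ident_comp[OF hm(1)] by simp
    then obtain v where "v \<in> Hom C Y M" "v \<bullet> g = ident C M"
      using dtri_extend[OF t ident_closed[OF Mo]] by blast
    then have "retract_of C M Y" unfolding retract_of_def using hm by blast
    moreover have "Y \<in> K" using Y unfolding weights_singleton by (auto simp: shift_int_0)
    ultimately show "M \<in> K" using retraction_closed_K Mo unfolding retraction_closed_def by blast
  qed
qed

lemma shift_weights_UNIV: "shift C ` weights UNIV = weights UNIV"
proof -
  have "(\<lambda>i::int. i + 1) ` UNIV = UNIV" using surj_def[of "\<lambda>i::int. i + 1"] by (metis diff_add_cancel)
  then show ?thesis using shift_weights by simp
qed

lemma densely_generates_weights_UNIV:
  assumes "densely_generates C D" "D \<subseteq> K"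
  shows "weights UNIV = Obj C"
proof
  show "weights UNIV \<subseteq> Obj C" by (rule weights_Obj)
  have "full_triangulated_subcategory C (weights UNIV)"
    using extension_closed_imp_full_triangulated[OF extension_closed_weights shift_weights_UNIV] .
  moreover have "D \<subseteq> weights UNIV" using assms(2) K_subset_weights by blast
  ultimately show "Obj C \<subseteq> weights UNIV"
    using assms(1) retraction_closed_weights_UNIV unfolding densely_generates_def by blast
qed

lemma weight_structure_weights:
  assumes "weights UNIV = Obj C"
  shows "weight_structure C (weights {..0}) (weights {0..})"
  unfolding weight_structure_def
proof (intro conjI ballI retraction_closed_weights_le retraction_closed_weights_ge)
  have le: "(\<lambda>i::int. i + 1) ` {..0} = {..1}"
    using image_add_atMost[of 1 "0::int"] by (simp add: add.commute)
  have ge: "(\<lambda>i::int. i + 1) ` {0..} = {1..}"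
    using image_add_atLeast[of 1 "0::int"] by (simp add: add.commute)
  show "weights {..0} \<subseteq> shift C ` weights {..0}"
    unfolding shift_weights le by (rule weights_mono) auto
  show "shift C ` weights {0..} \<subseteq> weights {0..}"
    unfolding shift_weights ge by (rule weights_mono) auto
  show "perp C (weights {..0}) (shift C ` weights {0..})"
    unfolding shift_weights ge by (rule perp_weights) auto
  fix M assume "M \<in> Obj C"
  then have M: "M \<in> weights UNIV" using assms by simp
  have "UNIV = {..0} \<union> {1::int..}" "\<forall>i \<in> {..0}. \<forall>j \<in> {1::int..}. i < j" by auto
  then obtain X Y f g h where t: "dtri X M Y f g h" "X \<in> weights {..0}" "Y \<in> weights {1..}"
    by (rule weights_decompose[OF M])
  then show "\<exists>f g h. (f, g, h) \<in> dist C \<and> Dom C f \<in> weights {..0} \<and> Cod C f = M \<and>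
      Cod C g \<in> shift C ` weights {0..}"
    unfolding shift_weights ge using dtri_dist[OF t(1)] by metis
qed

text \<open>A strict triangulated subcategory is extension-closed and shift-invariant, so once it
  contains \<open>K\<close> it contains every \<open>K[i]\<close> and all of
  \<open>weights UNIV\<close>.\<close>

lemma strongly_generates_K:
  assumes "weights UNIV = Obj C"
  shows "strongly_generates C K"
  unfolding strongly_generates_def
proof
  have "full_triangulated_subcategory C (Obj C)"
    using extension_closed_imp_full_triangulated[OF extension_closed_Obj image_shift_Obj] .
  moreover have "iso_closed C (Obj C)" unfolding iso_closed_def by blast
  ultimately show "\<Inter>{T. full_triangulated_subcategory C T \<and> iso_closed C T \<and> K \<subseteq> T} \<subseteq> Obj C"
    using K_Obj by blast
  show "Obj C \<subseteq> \<Inter>{T. full_triangulated_subcategory C T \<and> iso_closed C T \<and> K \<subseteq> T}"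
  proof (rule Inter_greatest, clarify)
    fix T M assume T: "full_triangulated_subcategory C T" "iso_closed C T" "K \<subseteq> T" and M: "M \<in> Obj C"
    have e: "extension_closed C T" using full_triangulated_imp_extension_closed T by blast
    have "shift C ` T = T" using T unfolding full_triangulated_subcategory_def by blast
    then have "shifts C UNIV K \<subseteq> T"
      using shifts_subset_of_shift_invariant[OF T(3) extension_closedD(1)[OF e]] by blast
    then have "weights UNIV \<subseteq> T" unfolding weights_def by (rule extension_closure_least[OF e])
    then show "M \<in> T" using assms M by blast
  qed
qed

end

section \<open>Envelopes as extension-closures, and the final assembly\<close>

context triangulated_category
begin

text \<open>A shift of a retract is a retract of the shift, so the envelope of the
  \<open>B[i]\<close> contains the shifts of \<open>Kar C B\<close> as well.\<close>

lemma extension_closure_Kar_subset_envelope: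
  assumes B: "B \<subseteq> Obj C"
  shows "extension_closure C (shifts C I (Kar C B)) \<subseteq> envelope C (shifts C I B)"
proof (rule extension_closure_least)
  note env = envelope_closed[OF shifts_Obj[OF B, of I]]
  show "extension_closed C (envelope C (shifts C I B))" by (rule env)
  show "shifts C I (Kar C B) \<subseteq> envelope C (shifts C I B)"
  proof
    fix M assume "M \<in> shifts C I (Kar C B)"
    then obtain i X where i: "i \<in> I" and X: "X \<in> Kar C B" "M = shift_int C i X"
      unfolding shifts_def by blast
    then obtain Y where Y: "Y \<in> B" "retract_of C X Y" "X \<in> Obj C" using Kar_eq[OF B] by blast
    have "shift_int C i Y \<in> envelope C (shifts C I B)"
      using i Y subset_envelope[of "shifts C I B"] unfolding shifts_def by blast
    moreover have "retract_of C M (shift_int C i Y)"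
      using retract_of_shift_int[OF Y(3) _ Y(2)] Y(1) B X(2) by blast
    moreover have "M \<in> Obj C" using X(2) shift_int_Obj[OF Y(3)] by simp
    ultimately show "M \<in> envelope C (shifts C I B)"
      using env(2) unfolding retraction_closed_def by blast
  qed
qed

end

theorem corollary2p1p2:
  fixes C :: "('o, 'm, 'z) triangulated_data_scheme" and B :: "'o set"
  assumes "triangulated_category C"
    and "full_additive_subcategory C B"
    and "negative C B"
    and "densely_generates C B"
  shows "let wle = envelope C (shifts C {..0} B); wge = envelope C (shifts C {0..} B) in
    weight_structure C wle wge \<and>
    heart wle wge = Kar C B \<and>
    (strongly_generates C (Kar C B) \<and>
      wle = extension_closure C (shifts C {..0} (Kar C B)) \<and>
      wge = extension_closure C (shifts C {0..} (Kar C B))) \<and>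
    (\<forall>vle vge. weight_structure C vle vge \<and> B \<subseteq> heart vle vge \<longleftrightarrow> vle = wle \<and> vge = wge)"
proof -
  interpret triangulated_category C by fact
  have B: "B \<subseteq> Obj C" using assms(2) unfolding full_additive_subcategory_def by blast
  interpret negative_heart C "Kar C B"
    by unfold_locales
      (use extension_closed_Kar assms retraction_closed_Kar negative_Kar B in auto)
  \<comment> \<open>Retraction-closedness makes \<open>weights I\<close> a competitor in the
    definition of the envelope, and so identifies the envelope with an extension-closure.\<close>
  have env: "envelope C (shifts C I B) = weights I" if "retraction_closed C (weights I)" for I
  proof
    have "shifts C I B \<subseteq> shifts C I (Kar C B)" using subset_Kar[of B] unfolding shifts_def by blast
    then have "shifts C I B \<subseteq> weights I" unfolding weights_def using subset_extension_closure by blast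
    then show "envelope C (shifts C I B) \<subseteq> weights I"
      by (rule envelope_least[OF extension_closed_weights that])
    show "weights I \<subseteq> envelope C (shifts C I B)"
      unfolding weights_def by (rule extension_closure_Kar_subset_envelope[OF B])
  qed
  note le = env[OF retraction_closed_weights_le] note ge = env[OF retraction_closed_weights_ge]
  have all: "weights UNIV = Obj C" using densely_generates_weights_UNIV[OF assms(4) subset_Kar] .
  note w = weight_structure_weights[OF all]
  \<comment> \<open>Both halves of a competing structure are extension- and retraction-closed and
    contain the relevant shifts of \<open>B\<close>, hence contain the envelopes; nested weight
    structures are equal.\<close>
  have unique: "vle = weights {..0} \<and> vge = weights {0..}"
    if v: "weight_structure C vle vge" and h: "B \<subseteq> heart vle vge" for vle vge
  proof -
    have sub: "B \<subseteq> vle" "B \<subseteq> vge" using h unfolding heart_def by auto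
    note ec = weight_structure_extension_closed[OF v]
    note rc = weight_structureD(1,2)[OF v]
    have "weights {..0} \<subseteq> vle" "weights {0..} \<subseteq> vge"
      using envelope_least[OF ec(1) rc(1) weight_structure_shifts_le[OF v sub(1)]]
        envelope_least[OF ec(2) rc(2) weight_structure_shifts_ge[OF v sub(2)]] le ge by auto
    then show ?thesis using weight_structure_antimono[OF v w] by blast
  qed
  have "B \<subseteq> heart (weights {..0}) (weights {0..})" using heart_weights subset_Kar by simp
  then have "weight_structure C vle vge \<and> B \<subseteq> heart vle vge \<longleftrightarrow>
      vle = weights {..0} \<and> vge = weights {0..}" for vle vge
    using unique w by blast
  then show ?thesis
    unfolding Let_def le ge
    using w heart_weights strongly_generates_K[OF all] weights_def by simp
qed

end
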